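(* Let $d \geq 2$, let $a \in \mathbb{R}^d$, and let $E$ be a compact subset of the translated unit sphere $a + \mathbb{S}^{d-1} = \{a + x : x \in \mathbb{R}^d, |x| = 1\}$. If $\dim_H E > \frac{d}{2}$, then there exists $x \in E$ such that the pinned dot product set $\Pi^x(E) = \{x \cdot y : y \in E\}$ has positive one-dimensional Lebesgue measure. In particular, the dot product set $\Pi(E) = \{x \cdot y : x, y \in E\}$ has positive Lebesgue measure.
   Context: $\dim_H$ denotes Hausdorff dimension. *)

theory Defs
  imports "HOL-Analysis.Analysis"
begin

(* The case distinction fixes the conventions diam({})^s = 0 and diam(U)^0 = 1 for U nonempty;
   "powr" alone would give 0 powr 0 = 0 for singletons. *)
definition diam_power :: "real \<Rightarrow> 'a::metric_space set \<Rightarrow> ennreal" where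
  "diam_power s U =
     (if U = {} then 0 else if s = 0 then 1 else ennreal (diameter U powr s))"

(* Boundedness is demanded because "diameter" returns an arbitrary real on unbounded sets. *)
definition delta_covers :: "real \<Rightarrow> 'a::metric_space set \<Rightarrow> (nat \<Rightarrow> 'a set) set" where
  "delta_covers \<delta> E =
     {U. E \<subseteq> (\<Union>i. U i) \<and> (\<forall>i. bounded (U i) \<and> diameter (U i) \<le> \<delta>)}"

definition hausdorff_content :: "real \<Rightarrow> real \<Rightarrow> 'a::metric_space set \<Rightarrow> ennreal" where
  "hausdorff_content \<delta> s E = (INF U\<in>delta_covers \<delta> E. \<Sum>i. diam_power s (U i))"

(* The content is antitone in \<delta>, so the supremum is the limit as \<delta> tends to 0. *)
definition hausdorff_measure :: "real \<Rightarrow> 'a::metric_space set \<Rightarrow> ennreal" where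
  "hausdorff_measure s E = (SUP \<delta>\<in>{0<..}. hausdorff_content \<delta> s E)"

definition hausdorff_dim :: "'a::metric_space set \<Rightarrow> ennreal" where
  "hausdorff_dim E = Inf {ennreal s | s. 0 \<le> s \<and> hausdorff_measure s E = 0}"

definition pinned_dot_set :: "'a::real_inner \<Rightarrow> 'a set \<Rightarrow> real set" where
  "pinned_dot_set x E = {x \<bullet> y | y. y \<in> E}"

definition dot_set :: "'a::real_inner set \<Rightarrow> real set" where
  "dot_set E = {x \<bullet> y | x y. x \<in> E \<and> y \<in> E}"

end

theory Submission
  imports Defs "HOL-Probability.Probability" "HOL-Real_Asymp.Real_Asymp"
begin

text \<open>
  Fix \<open>d/2 < t < dim E\<close> and a Frostman measure \<open>\<mu>\<close> on \<open>E\<close>, so \<open>\<mu>(B(x,r)) \<le> C r\<^sup>t\<close>. Damping the kernel by a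
  Gaussian and writing Gaussians as Fourier integrals, the average over \<open>x\<close> of the squared
  \<open>L\<^sup>2\<close>-norms of the images of \<open>\<mu>\<close> under \<open>y \<mapsto> x \<bullet> y\<close>, smoothed at scale \<open>\<delta>\<close>, is at most
  \<open>\<integral> |\<mu>^(\<xi>)|\<^sup>2 M(\<xi>) d\<xi>\<close>, where \<open>M(\<xi>) = \<integral>\<integral> exp(-|\<xi> - r x|\<^sup>2/2) dr d\<mu>(x)\<close> measures how much of the cone over
  \<open>E\<close> is close to \<open>\<xi>\<close>. If the sphere is transversal to the rays from the origin, \<open>M(\<xi>) \<le> C |\<xi>|\<^sup>-\<^sup>t\<close>, so the
  integral is an energy of exponent \<open>d - t < t\<close> and is finite, uniformly in \<open>\<delta>\<close>. On the other hand,
  if all projections had measure zero, the smoothed norms would tend to infinity for every \<open>x\<close>,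
  which contradicts Fatou's lemma. Transversality holds on countably many pieces of \<open>E\<close>; the points
  where a ray is tangent to the sphere all have the same norm and hence lie on a sphere about
  the origin, which is again transversal.\<close>

subsection \<open>Hausdorff content\<close>

lemma hausdorff_content_mono:
  assumes "A \<subseteq> B"
  shows "hausdorff_content \<delta> s A \<le> hausdorff_content \<delta> s B"
  unfolding hausdorff_content_def
  by (rule INF_superset_mono) (use assms in \<open>auto simp: delta_covers_def\<close>)

text \<open>Near-optimal covers of the \<open>A i\<close>, with errors \<open>e / 2 ^ Suc i\<close>,
  are merged into one sequence through the pairing of indices; the errors add up to
  \<open>e\<close>.\<close>

lemma hausdorff_content_UN:
  "hausdorff_content \<delta> s (\<Union>i. A i) \<le> (\<Sum>i. hausdorff_content \<delta> s (A i))"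
proof (rule ennreal_le_epsilon)
  fix e :: real
  assume fin: "(\<Sum>i. hausdorff_content \<delta> s (A i)) < top" and e: "0 < e"
  have ex: "\<exists>U\<in>delta_covers \<delta> (A i).
      (\<Sum>j. diam_power s (U j)) < hausdorff_content \<delta> s (A i) + ennreal (e * (1/2) ^ Suc i)" for i
  proof -
    have "hausdorff_content \<delta> s (A i) < top"
      using ennreal_suminf_lessD fin by blast
    moreover have "0 < ennreal (e * (1/2) ^ Suc i)"
      using e by simp
    ultimately have "hausdorff_content \<delta> s (A i)
        < hausdorff_content \<delta> s (A i) + ennreal (e * (1/2) ^ Suc i)"
      by (simp add: ennreal_add_left_cancel_less[of _ 0, simplified] less_top[symmetric])
    then show ?thesis
      unfolding hausdorff_content_def by (auto simp: INF_less_iff)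
  qed
  then obtain U where U: "\<And>i. U i \<in> delta_covers \<delta> (A i)"
    "\<And>i. (\<Sum>j. diam_power s (U i j)) < hausdorff_content \<delta> s (A i) + ennreal (e * (1/2) ^ Suc i)"
    by metis
  define V where "V n = (case prod_decode n of (i, j) \<Rightarrow> U i j)" for n
  have V: "V \<in> delta_covers \<delta> (\<Union>i. A i)"
  proof -
    have "x \<in> (\<Union>n. V n)" if x: "x \<in> A i" for i x
    proof -
      obtain j where "x \<in> U i j"
        using U(1)[of i] x unfolding delta_covers_def by blast
      then have "x \<in> V (prod_encode (i, j))"
        by (simp add: V_def)
      then show ?thesis by blast
    qed
    then show ?thesis
      using U(1) unfolding delta_covers_def by (auto simp: V_def split: prod.split)
  qed
  have "hausdorff_content \<delta> s (\<Union>i. A i) \<le> (\<Sum>n. diam_power s (V n))"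
    unfolding hausdorff_content_def by (rule INF_lower[OF V])
  also have "\<dots> = (\<Sum>n. case_prod (\<lambda>i j. diam_power s (U i j)) (prod_decode n))"
    by (simp add: V_def split_beta)
  also have "\<dots> = (\<Sum>i. \<Sum>j. diam_power s (U i j))"
    by (rule suminf_ennreal_2dimen) simp
  also have "\<dots> \<le> (\<Sum>i. hausdorff_content \<delta> s (A i) + ennreal (e * (1/2) ^ Suc i))"
    by (intro suminf_le less_imp_le U) auto
  also have "\<dots> = (\<Sum>i. hausdorff_content \<delta> s (A i)) + (\<Sum>i. ennreal (e * (1/2) ^ Suc i))"
    by (rule suminf_add[symmetric]) auto
  also have "(\<Sum>i. ennreal (e * (1/2) ^ Suc i)) = ennreal e"
  proof -
    have "(\<lambda>i. e * (1/2::real) ^ Suc i) sums (e * 1)"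
      by (intro sums_mult power_half_series)
    then show ?thesis
      using e by (intro suminf_ennreal_eq) auto
  qed
  finally show "hausdorff_content \<delta> s (\<Union>i. A i) \<le> (\<Sum>i. hausdorff_content \<delta> s (A i)) + ennreal e" .
qed

lemma hausdorff_content_empty:
  assumes "0 \<le> \<delta>"
  shows "hausdorff_content \<delta> s ({} :: 'a::metric_space set) = 0"
proof -
  have "(\<lambda>_. {}) \<in> delta_covers \<delta> ({} :: 'a set)"
    using assms by (simp add: delta_covers_def)
  then have "hausdorff_content \<delta> s ({} :: 'a set) \<le> (\<Sum>i::nat. diam_power s ({} :: 'a set))"
    unfolding hausdorff_content_def by (rule INF_lower2) simp
  then show ?thesis by (simp add: diam_power_def)
qed

lemma hausdorff_content_le_diam_power:
  assumes "bounded A" "diameter A \<le> \<delta>" "0 \<le> \<delta>"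
  shows "hausdorff_content \<delta> s A \<le> diam_power s A"
proof -
  define U where "U i = (if i = 0 then A else {})" for i :: nat
  have "U \<in> delta_covers \<delta> A"
    using assms by (auto simp: delta_covers_def U_def)
  then have "hausdorff_content \<delta> s A \<le> (\<Sum>i. diam_power s (U i))"
    unfolding hausdorff_content_def by (rule INF_lower)
  also have "\<dots> = (\<Sum>i\<in>{0}. diam_power s (U i))"
    by (rule suminf_finite) (auto simp: U_def diam_power_def)
  finally show ?thesis by (simp add: U_def)
qed

lemma hausdorff_content_Un:
  assumes "0 \<le> \<delta>"
  shows "hausdorff_content \<delta> s (A \<union> B) \<le> hausdorff_content \<delta> s A + hausdorff_content \<delta> s B"
proof -
  define C where "C i = (if i = 0 then A else if i = Suc 0 then B else {})" for i :: nat
  have "A \<union> B = (\<Union>i. C i)"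
    by (auto simp: C_def split: if_splits)
  then have "hausdorff_content \<delta> s (A \<union> B) \<le> (\<Sum>i. hausdorff_content \<delta> s (C i))"
    by (simp add: hausdorff_content_UN)
  also have "\<dots> = (\<Sum>i\<in>{0, Suc 0}. hausdorff_content \<delta> s (C i))"
    by (rule suminf_finite) (use assms in \<open>auto simp: C_def hausdorff_content_empty\<close>)
  finally show ?thesis by (simp add: C_def)
qed

text \<open>A pigeonhole principle: it allows passing to a piece of \<open>E\<close> with uniform
  geometry while keeping the same exponent and the same scale.\<close>

lemma hausdorff_content_pos_UN:
  assumes "0 < hausdorff_content \<delta> s E" "E \<subseteq> (\<Union>i::nat. A i)"
  shows "\<exists>i. 0 < hausdorff_content \<delta> s (A i)"
proof (rule ccontr)
  assume "\<not> ?thesis"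
  then have "hausdorff_content \<delta> s (\<Union>i. A i) = 0"
    using hausdorff_content_UN[of \<delta> s A] by simp
  then show False
    using hausdorff_content_mono[OF assms(2), of \<delta> s] assms(1) by simp
qed

lemma diameter_cball_le:
  fixes x :: "'a::real_normed_vector"
  assumes "0 \<le> r" "A \<subseteq> cball x r"
  shows "diameter A \<le> 2 * r"
proof (rule diameter_le)
  fix y z assume "y \<in> A" "z \<in> A"
  then have "dist y x \<le> r" "dist z x \<le> r" using assms by (auto simp: dist_commute subset_iff)
  then show "norm (y - z) \<le> 2 * r"
    using dist_triangle2[of y z x] by (simp add: dist_norm)
qed (use assms in auto)

text \<open>Finitely many balls of radius \<open>\<delta> / 2\<close> suffice, and each has finite
  cost. This makes the content usable as a real-valued set function in
  \<open>frostman\<close>.\<close>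

lemma hausdorff_content_finite:
  fixes E :: "'a::euclidean_space set"
  assumes "compact E" "0 < \<delta>"
  shows "hausdorff_content \<delta> s E < top"
proof -
  obtain F where F: "finite F" "E \<subseteq> (\<Union>x\<in>F. ball x (\<delta>/2))"
    using seq_compact_imp_totally_bounded[OF compact_imp_seq_compact[OF assms(1)]] assms(2)
    by (meson half_gt_zero)
  have "hausdorff_content \<delta> s (\<Union>x\<in>G. ball x (\<delta>/2)) < top" if "finite G" for G :: "'a set"
    using that
  proof induction
    case empty
    then show ?case using assms(2) by (simp add: hausdorff_content_empty)
  next
    case (insert x G)
    have "hausdorff_content \<delta> s (ball x (\<delta>/2)) \<le> diam_power s (ball x (\<delta>/2))"
      using diameter_cball_le[of "\<delta>/2" "ball x (\<delta>/2)" x] assms(2)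
      by (intro hausdorff_content_le_diam_power) auto
    also have "\<dots> < top" by (simp add: diam_power_def)
    finally have "hausdorff_content \<delta> s (ball x (\<delta>/2)) < top" .
    then have "hausdorff_content \<delta> s (ball x (\<delta>/2))
        + hausdorff_content \<delta> s (\<Union>x\<in>G. ball x (\<delta>/2)) < top"
      using insert by simp
    then show ?case
      using hausdorff_content_Un[of \<delta> s "ball x (\<delta>/2)" "\<Union>x\<in>G. ball x (\<delta>/2)"] assms(2)
      by (simp add: order.strict_trans1)
  qed
  then show ?thesis
    using hausdorff_content_mono[OF F(2), of \<delta> s] F(1) order.strict_trans1 by blast
qed

text \<open>The exponent is chosen strictly between \<open>d\<close> and the dimension; a nonzero
  supremum over scales is nonzero at some scale. From here on the content at this one scale replaces
  the measure, which may be infinite.\<close>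

lemma hausdorff_dim_gt_imp_content_pos:
  assumes "ennreal d < hausdorff_dim E" "0 \<le> d"
  shows "\<exists>t>d. \<exists>\<delta>>0. 0 < hausdorff_content \<delta> t E"
proof -
  obtain u where u: "ennreal d < u" "u < hausdorff_dim E"
    using dense assms(1) by blast
  then obtain t where t: "u = ennreal t" "0 \<le> t"
    by (cases u) auto
  have "d < t" using u t assms(2) by (simp add: ennreal_less_iff)
  have "hausdorff_measure t E \<noteq> 0"
  proof
    assume "hausdorff_measure t E = 0"
    then have "hausdorff_dim E \<le> ennreal t"
      unfolding hausdorff_dim_def by (intro Inf_lower) (use t in auto)
    then show False using u t by simp
  qed
  then obtain \<delta> where "\<delta> > 0" "hausdorff_content \<delta> t E \<noteq> 0"
    unfolding hausdorff_measure_def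
    by (auto simp flip: bot_ennreal simp: SUP_bot_conv)
  then show ?thesis using \<open>d < t\<close> by (auto simp: zero_less_iff_neq_zero)
qed

subsection \<open>Frostman measures\<close>

text \<open>An integer point serving as the label of the half-open dyadic cube of side
  \<open>1 / 2 ^ n\<close> around \<open>x\<close>.\<close>

definition grid :: "nat \<Rightarrow> 'a::euclidean_space \<Rightarrow> 'a" where
  "grid n x = (\<Sum>i\<in>Basis. of_int \<lfloor>2 ^ n * (x \<bullet> i)\<rfloor> *\<^sub>R i)"

lemma grid_eq_iff: "grid n x = grid n y \<longleftrightarrow> (\<forall>i\<in>Basis. \<lfloor>2 ^ n * (x \<bullet> i)\<rfloor> = \<lfloor>2 ^ n * (y \<bullet> i)\<rfloor>)"
  unfolding grid_def by (subst euclidean_eq_iff) simp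

lemma norm_diff_le_grid:
  fixes x y :: "'a::euclidean_space"
  assumes "grid n x = grid n y"
  shows "norm (x - y) \<le> DIM('a) / 2 ^ n"
proof -
  have "\<bar>(x - y) \<bullet> i\<bar> \<le> 1 / 2 ^ n" if "i \<in> Basis" for i
  proof -
    have "\<lfloor>2 ^ n * (x \<bullet> i)\<rfloor> = \<lfloor>2 ^ n * (y \<bullet> i)\<rfloor>"
      using assms that by (simp add: grid_eq_iff)
    then have "\<bar>2 ^ n * (x \<bullet> i) - 2 ^ n * (y \<bullet> i)\<bar> \<le> 1" by linarith
    then have "2 ^ n * \<bar>x \<bullet> i - y \<bullet> i\<bar> \<le> 1"
      by (simp add: abs_mult flip: right_diff_distrib)
    then show ?thesis by (simp add: inner_diff_left field_simps)
  qed
  then have "(\<Sum>i\<in>Basis. \<bar>(x - y) \<bullet> i\<bar>) \<le> DIM('a) * (1 / 2 ^ n)"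
    by (intro sum_bounded_above) auto
  then show ?thesis using norm_le_l1[of "x - y"] by simp
qed

text \<open>Dyadic cubes are nested: integer division by 2 turns the finer integer coordinates into
  the coarser ones.\<close>

lemma grid_Suc_imp_grid:
  assumes "grid (Suc n) x = grid (Suc n) y"
  shows "grid n x = grid n y"
proof -
  have "\<lfloor>2 ^ n * v\<rfloor> = \<lfloor>2 ^ Suc n * v\<rfloor> div 2" for v :: real
    using floor_divide_real_eq_div[of 2 "2 ^ Suc n * v"] by simp
  then show ?thesis using assms unfolding grid_eq_iff by metis
qed

text \<open>Each integer coordinate of a point in the ball differs from that of \<open>p\<close> by
  at most \<open>M\<close>, which leaves \<open>2 * M + 1\<close> values per axis.\<close>

lemma card_grid_cball:
  fixes p :: "'a::euclidean_space" and M :: nat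
  shows "finite (grid n ` cball p (M / 2 ^ n)) \<and> card (grid n ` cball p (M / 2 ^ n)) \<le> (2 * M + 1) ^ DIM('a)"
proof -
  define R where "R i = {\<lfloor>2 ^ n * (p \<bullet> i)\<rfloor> - int M .. \<lfloor>2 ^ n * (p \<bullet> i)\<rfloor> + int M}" for i
  define h where "h f = (\<Sum>i\<in>Basis. of_int (f i) *\<^sub>R i :: 'a)" for f :: "'a \<Rightarrow> int"
  have "grid n x \<in> h ` (\<Pi>\<^sub>E i\<in>Basis. R i)" if x: "x \<in> cball p (M / 2 ^ n)" for x
  proof (rule image_eqI)
    show "grid n x = h (restrict (\<lambda>i. \<lfloor>2 ^ n * (x \<bullet> i)\<rfloor>) Basis)"
      by (simp add: grid_def h_def)
    have "\<lfloor>2 ^ n * (x \<bullet> i)\<rfloor> \<in> R i" if i: "i \<in> Basis" for i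
    proof -
      have "\<bar>x \<bullet> i - p \<bullet> i\<bar> \<le> M / 2 ^ n"
        using Basis_le_norm[OF i, of "x - p"] x by (simp add: dist_norm norm_minus_commute inner_diff_left)
      then have "2 ^ n * \<bar>x \<bullet> i - p \<bullet> i\<bar> \<le> M"
        by (simp add: field_simps)
      then have "\<bar>2 ^ n * (x \<bullet> i) - 2 ^ n * (p \<bullet> i)\<bar> \<le> real M"
        by (simp add: abs_mult flip: right_diff_distrib)
      then show ?thesis unfolding R_def atLeastAtMost_iff by linarith
    qed
    then show "restrict (\<lambda>i. \<lfloor>2 ^ n * (x \<bullet> i)\<rfloor>) Basis \<in> (\<Pi>\<^sub>E i\<in>Basis. R i)"
      by auto
  qed
  then have sub: "grid n ` cball p (M / 2 ^ n) \<subseteq> h ` (\<Pi>\<^sub>E i\<in>Basis. R i)" by blast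
  have fin: "finite (\<Pi>\<^sub>E i\<in>(Basis::'a set). R i)"
    by (intro finite_PiE) (auto simp: R_def)
  have "card (R i) = 2 * M + 1" for i
    by (simp add: R_def)
  then have "card (\<Pi>\<^sub>E i\<in>(Basis::'a set). R i) = (2 * M + 1) ^ DIM('a)"
    by (simp add: card_PiE)
  then have "card (h ` (\<Pi>\<^sub>E i\<in>Basis. R i)) \<le> (2 * M + 1) ^ DIM('a)"
    using card_image_le[OF fin, of h] by simp
  then show ?thesis
    using finite_subset[OF sub finite_imageI[OF fin]] card_mono[OF finite_imageI[OF fin] sub] by simp
qed

lemma finite_grid_image:
  fixes E :: "'a::euclidean_space set"
  assumes "bounded E"
  shows "finite (grid n ` E)"
proof -
  obtain b where b: "\<And>x. x \<in> E \<Longrightarrow> norm x \<le> b"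
    using assms by (auto simp: bounded_iff)
  define M where "M = nat \<lceil>b * 2 ^ n\<rceil>"
  have "b * 2 ^ n \<le> real M" unfolding M_def by linarith
  then have "b \<le> M / 2 ^ n"
    by (simp add: field_simps)
  then have "E \<subseteq> cball 0 (M / 2 ^ n)"
    using b order_trans by (auto simp: subset_iff)
  then show ?thesis
    using card_grid_cball[of n 0 M] by (meson finite_subset image_mono)
qed

text \<open>Codes ordering the dyadic cells of all levels lexicographically, so that cells of level
  \<open>n\<close> are intervals for the codes of level \<open>n + 1\<close>.\<close>

primrec grid_code :: "'a::euclidean_space set \<Rightarrow> nat \<Rightarrow> 'a \<Rightarrow> nat" where
  "grid_code E 0 x = to_nat_on (grid 0 ` E) (grid 0 x)"
| "grid_code E (Suc n) x = grid_code E n x * card (grid (Suc n) ` E) + to_nat_on (grid (Suc n) ` E) (grid (Suc n) x)"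

lemma to_nat_on_grid:
  assumes "bounded E" "x \<in> E"
  shows "to_nat_on (grid n ` E) (grid n x) < card (grid n ` E)"
  using bij_betwE[OF to_nat_on_finite[OF finite_grid_image[OF assms(1), of n]]] assms(2) by auto

lemma to_nat_on_grid_eq_iff:
  assumes "bounded E" "x \<in> E" "y \<in> E"
  shows "to_nat_on (grid n ` E) (grid n x) = to_nat_on (grid n ` E) (grid n y) \<longleftrightarrow> grid n x = grid n y"
  using bij_betw_imp_inj_on[OF to_nat_on_finite[OF finite_grid_image[OF assms(1), of n]]] assms(2,3)
  by (auto simp: inj_on_def)

text \<open>The last digit is recovered as a remainder and already determines the cell. Conversely,
  the leading digits of points in one cell agree because cells are nested.\<close>

lemma grid_code_eq_iff:
  assumes "bounded E" "x \<in> E" "y \<in> E"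
  shows "grid_code E n x = grid_code E n y \<longleftrightarrow> grid n x = grid n y"
proof (induction n)
  case 0
  then show ?case using to_nat_on_grid_eq_iff[OF assms] by simp
next
  case (Suc n)
  let ?B = "card (grid (Suc n) ` E)"
  let ?t = "\<lambda>z. to_nat_on (grid (Suc n) ` E) (grid (Suc n) z)"
  have lt: "?t x < ?B" "?t y < ?B" using assms by (auto intro: to_nat_on_grid)
  show ?case
  proof
    assume "grid_code E (Suc n) x = grid_code E (Suc n) y"
    then have "(grid_code E n x * ?B + ?t x) mod ?B = (grid_code E n y * ?B + ?t y) mod ?B"
      by simp
    then have "?t x = ?t y" using lt by simp
    then show "grid (Suc n) x = grid (Suc n) y"
      using to_nat_on_grid_eq_iff[OF assms] by blast
  next
    assume "grid (Suc n) x = grid (Suc n) y"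
    moreover from this have "grid_code E n x = grid_code E n y"
      using grid_Suc_imp_grid Suc by blast
    ultimately show "grid_code E (Suc n) x = grid_code E (Suc n) y" by simp
  qed
qed

text \<open>The code is a mixed-radix number whose new digit stays below its base, so a strict
  inequality between leading parts survives refinement.\<close>

lemma grid_code_less:
  assumes "bounded E" "x \<in> E" "grid_code E n x < grid_code E n y"
  shows "grid_code E (Suc n) x < grid_code E (Suc n) y"
proof -
  let ?B = "card (grid (Suc n) ` E)"
  have "grid_code E (Suc n) x < Suc (grid_code E n x) * ?B"
    using to_nat_on_grid[OF assms(1,2), of "Suc n"] by simp
  also have "\<dots> \<le> grid_code E n y * ?B"
    using assms(3) by (intro mult_le_mono1) simp
  finally show ?thesis by simp
qed

text \<open>Ordering the points of \<open>E\<close> by their codes, the content of initial segments behaves like a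
  distribution function: by subadditivity its increment over a cell is at most the content of the
  cell. The Frostman measure is the image of Lebesgue measure under the corresponding quantile
  map, obtained as a limit over the levels of the grid.\<close>

lemma frostman:
  fixes E :: "'a::euclidean_space set"
  assumes E: "compact E" and \<delta>: "0 < \<delta>" and pos: "0 < hausdorff_content \<delta> t E" and t: "0 < t"
  shows "\<exists>\<mu> C. finite_measure \<mu> \<and> sets \<mu> = sets borel \<and> 0 < measure \<mu> (space \<mu>) \<and> (AE x in \<mu>. x \<in> E)
     \<and> 0 \<le> C \<and> (\<forall>x r. 0 < r \<longrightarrow> emeasure \<mu> (cball x r) \<le> ennreal (C * r powr t))"
proof -
  have bE: "bounded E" using E by (rule compact_imp_bounded)
  define d where "d = DIM('a)"
  have d: "0 < d" by (simp add: d_def)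
  define c where "c A = enn2real (hausdorff_content \<delta> t A)" for A :: "'a set"
  have c: "hausdorff_content \<delta> t A = ennreal (c A)" if "A \<subseteq> E" for A
    unfolding c_def using hausdorff_content_mono[OF that, of \<delta> t] hausdorff_content_finite[OF E \<delta>, of t]
    by (auto simp: order.strict_trans1)
  have c0: "0 \<le> c A" for A by (simp add: c_def)
  have c_mono: "c A \<le> c B" if "A \<subseteq> B" "B \<subseteq> E" for A B
    using hausdorff_content_mono[OF that(1), of \<delta> t] c[OF that(2)] c[of A] that c0 by simp
  have c_Un: "c (A \<union> B) \<le> c A + c B" if "A \<subseteq> E" "B \<subseteq> E" for A B
  proof -
    have "ennreal (c (A \<union> B)) \<le> ennreal (c A) + ennreal (c B)"
      using hausdorff_content_Un[of \<delta> t A B] \<delta> c[of "A \<union> B"] c[of A] c[of B] that by simp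
    then show ?thesis using c0 by (simp flip: ennreal_plus)
  qed
  have cE: "0 < c E" using pos c[of E] by simp
  have c_empty: "c {} = 0" using \<delta> by (simp add: c_def hausdorff_content_empty)
  define K where "K = grid_code E"
  define F where "F n k = c {y \<in> E. K n y < k}" for n k
  have F_mono: "F n j \<le> F n k" if "j \<le> k" for n j k
    unfolding F_def using that by (intro c_mono) auto
  have F_0: "F n 0 = 0" for n by (simp add: F_def c_empty)
  have F_Suc: "F n (Suc k) - F n k \<le> c {y \<in> E. K n y = k}" for n k
  proof -
    have "{y \<in> E. K n y < Suc k} = {y \<in> E. K n y < k} \<union> {y \<in> E. K n y = k}" by auto
    then show ?thesis using c_Un[of "{y \<in> E. K n y < k}" "{y \<in> E. K n y = k}"] by (simp add: F_def)
  qed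
  have K_norm: "norm (x - y) \<le> d / 2 ^ n" if "x \<in> E" "y \<in> E" "K n x = K n y" for x y n
    using norm_diff_le_grid[of n x y] grid_code_eq_iff[OF bE that(1,2)] that(3) by (simp add: K_def d_def)
  \<comment> \<open>At levels fine enough for the scale \<open>\<delta>\<close>, a cell is an
    admissible cover of itself.\<close>
  have c_cell: "c {y \<in> E. K n y = k} \<le> (d / 2 ^ n) powr t" if n: "d / 2 ^ n \<le> \<delta>" for n k
  proof (cases "{y \<in> E. K n y = k} = {}")
    case True
    then show ?thesis by (simp only: c_empty) simp
  next
    case False
    let ?A = "{y \<in> E. K n y = k}"
    have bA: "bounded ?A" using bE by (rule bounded_subset) auto
    have diam: "diameter ?A \<le> d / 2 ^ n"
      by (rule diameter_le) (use K_norm False in auto)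
    have "ennreal (c ?A) \<le> diam_power t ?A"
      using hausdorff_content_le_diam_power[OF bA, of \<delta> t] diam n \<delta> c[of ?A] by auto
    also have "\<dots> \<le> ennreal ((d / 2 ^ n) powr t)"
      using False t diam diameter_ge_0[OF bA] by (auto simp: diam_power_def intro!: ennreal_leI powr_mono2)
    finally show ?thesis by simp
  qed
  have F_top: "\<exists>k. F n k = c E" for n
  proof -
    have "finite (K n ` E)"
    proof -
      have "K n ` E \<subseteq> (\<lambda>g. K n (SOME x. x \<in> E \<and> grid n x = g)) ` (grid n ` E)"
      proof (rule image_subsetI)
        fix x assume x: "x \<in> E"
        then have "(SOME z. z \<in> E \<and> grid n z = grid n x) \<in> E \<and> grid n (SOME z. z \<in> E \<and> grid n z = grid n x) = grid n x"
          by (metis (mono_tags, lifting) someI)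
        then have "K n x = K n (SOME z. z \<in> E \<and> grid n z = grid n x)"
          using grid_code_eq_iff[OF bE x] by (simp add: K_def)
        then show "K n x \<in> (\<lambda>g. K n (SOME x. x \<in> E \<and> grid n x = g)) ` (grid n ` E)"
          using x by blast
      qed
      then show ?thesis using finite_grid_image[OF bE] finite_subset by blast
    qed
    then obtain k where "\<And>y. y \<in> E \<Longrightarrow> K n y < k"
      using finite_nat_bounded by (metis image_subset_iff lessThan_iff)
    then have "{y \<in> E. K n y < k} = E" by auto
    then show ?thesis by (auto simp: F_def intro!: exI[of _ k])
  qed
  define \<Omega> where "\<Omega> = {0..<c E}"
  \<comment> \<open>The quantile index: the half-open intervals from \<open>F n k\<close> to
    \<open>F n (Suc k)\<close> partition \<open>\<Omega>\<close>, and \<open>\<kappa> n w\<close> is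
    the code whose interval contains \<open>w\<close>.\<close>
  define \<kappa> where "\<kappa> n w = (LEAST k. w < F n (Suc k))" for n w
  have \<kappa>: "F n (\<kappa> n w) \<le> w" "w < F n (Suc (\<kappa> n w))" if w: "w \<in> \<Omega>" for n w
  proof -
    obtain k where k: "F n k = c E" using F_top by blast
    then have "w < F n (Suc k)" using F_mono[of k "Suc k" n] w by (simp add: \<Omega>_def)
    then show "w < F n (Suc (\<kappa> n w))" unfolding \<kappa>_def by (rule LeastI)
    show "F n (\<kappa> n w) \<le> w"
    proof (cases "\<kappa> n w")
      case 0
      then show ?thesis using w by (simp add: F_0 \<Omega>_def)
    next
      case (Suc j)
      then have "\<not> w < F n (Suc j)" unfolding \<kappa>_def by (intro not_less_Least) simp
      then show ?thesis using Suc by simp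
    qed
  qed
  have \<kappa>_unique: "\<kappa> n w = k" if "w \<in> \<Omega>" "F n k \<le> w" "w < F n (Suc k)" for n w k
  proof (rule ccontr)
    assume "\<kappa> n w \<noteq> k"
    then consider "Suc (\<kappa> n w) \<le> k" | "Suc k \<le> \<kappa> n w" by linarith
    then show False
      using F_mono[of "Suc (\<kappa> n w)" k n] F_mono[of "Suc k" "\<kappa> n w" n] \<kappa>[OF that(1), of n] that(2,3)
      by cases linarith+
  qed
  \<comment> \<open>A code taken by no point of \<open>E\<close> has an empty interval, so it is
    never selected.\<close>
  have \<kappa>_ex: "\<exists>x. x \<in> E \<and> K n x = \<kappa> n w" if w: "w \<in> \<Omega>" for n w
  proof (rule ccontr)
    assume "\<not> ?thesis"
    then have "{y \<in> E. K n y < Suc (\<kappa> n w)} = {y \<in> E. K n y < \<kappa> n w}"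
      by (auto simp: less_Suc_eq)
    then show False using \<kappa>[OF w, of n] by (simp add: F_def)
  qed
  define X where "X n w = (SOME x. x \<in> E \<and> K n x = \<kappa> n w)" for n w
  have X: "X n w \<in> E" "K n (X n w) = \<kappa> n w" if "w \<in> \<Omega>" for n w
    using someI_ex[OF \<kappa>_ex[OF that, of n]] by (auto simp: X_def)
  \<comment> \<open>Initial segments of level \<open>n\<close> and \<open>Suc n\<close> are nested
    because refinement preserves strict order of codes. Hence the interval of a cell lies inside the
    interval of its parent.\<close>
  have nest: "K n x = \<kappa> n w" if w: "w \<in> \<Omega>" and x: "x \<in> E" "K (Suc n) x = \<kappa> (Suc n) w" for n w x
  proof -
    have "F n (K n x) \<le> F (Suc n) (K (Suc n) x)"
      unfolding F_def using grid_code_less[OF bE] by (intro c_mono) (auto simp: K_def)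
    moreover have "F (Suc n) (Suc (K (Suc n) x)) \<le> F n (Suc (K n x))"
      unfolding F_def using grid_code_less[OF bE x(1)]
      by (intro c_mono) (auto simp: K_def less_Suc_eq_le not_less[symmetric] simp del: grid_code.simps)
    ultimately show ?thesis
      using \<kappa>[OF w, of "Suc n"] x(2) by (intro \<kappa>_unique[symmetric] w) auto
  qed
  have nest_add: "K n x = \<kappa> n w" if w: "w \<in> \<Omega>" and x: "x \<in> E" "K (n + j) x = \<kappa> (n + j) w" for n j w x
    using x(2) by (induction j) (use nest[OF w x(1)] in auto)
  have X_norm: "norm (X m w - X n w) \<le> d / 2 ^ n" if "w \<in> \<Omega>" "n \<le> m" for w n m
  proof -
    have "K n (X m w) = \<kappa> n w"
      using nest_add[OF that(1) X(1)[OF that(1)], of n "m - n" m] X(2)[OF that(1)] that(2) by simp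
    then show ?thesis using K_norm X that(1) by metis
  qed
  have d_lim: "(\<lambda>n. d / 2 ^ n) \<longlonglongrightarrow> 0"
    using LIMSEQ_divide_realpow_zero[of 2 "real d"] by simp
  \<comment> \<open>For fixed \<open>w\<close> the points \<open>X n w\<close> lie in nested cells
    of diameter at most \<open>d / 2 ^ n\<close>, so they converge. The limit is the quantile map
    that transports Lebesgue measure on \<open>\<Omega>\<close> to \<open>E\<close>.\<close>
  define Y where "Y w = lim (\<lambda>n. X n w)" for w
  have Y: "(\<lambda>n. X n w) \<longlonglongrightarrow> Y w" if w: "w \<in> \<Omega>" for w
  proof -
    have "Cauchy (\<lambda>n. X n w)"
    proof (rule metric_CauchyI)
      fix e :: real assume "0 < e"
      then obtain N where N: "d / 2 ^ N < e / 2"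
        using order_tendstoD(2)[OF d_lim, of "e / 2"] by (auto simp: eventually_sequentially)
      have "dist (X m w) (X n w) < e" if "N \<le> m" "N \<le> n" for m n
        using dist_triangle2[of "X m w" "X n w" "X N w"] X_norm[OF w that(1)] X_norm[OF w that(2)] N
        unfolding dist_norm by linarith
      then show "\<exists>M. \<forall>m\<ge>M. \<forall>n\<ge>M. dist (X m w) (X n w) < e" by blast
    qed
    then show ?thesis
      unfolding Y_def by (simp add: Cauchy_convergent_iff convergent_LIMSEQ_iff)
  qed
  have Y_E: "Y w \<in> E" if w: "w \<in> \<Omega>" for w
    using closed_sequentially[OF compact_imp_closed[OF E] _ Y[OF w]] X(1)[OF w] by blast
  have Y_norm: "norm (Y w - X n w) \<le> d / 2 ^ n" if w: "w \<in> \<Omega>" for w n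
  proof (rule tendsto_upperbound)
    show "((\<lambda>m. norm (X m w - X n w)) \<longlongrightarrow> norm (Y w - X n w)) sequentially"
      by (intro tendsto_intros Y w)
    show "eventually (\<lambda>m. norm (X m w - X n w) \<le> d / 2 ^ n) sequentially"
      using X_norm[OF w] by (auto simp: eventually_sequentially)
  qed simp
  define M where "M = restrict_space lborel \<Omega>"
  have spM: "space M = \<Omega>" by (simp add: M_def space_restrict_space)
  have \<Omega>: "\<Omega> \<in> sets lborel" by (simp add: \<Omega>_def)
  have X_meas: "X n \<in> borel_measurable M" for n
  proof -
    have "\<kappa> n \<in> measurable borel (count_space UNIV)"
      unfolding \<kappa>_def by measurable
    then have "X n \<in> borel_measurable borel"
      unfolding X_def by measurable
    then show ?thesis unfolding M_def by (intro measurable_restrict_space1) simp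
  qed
  have Y_meas [measurable]: "Y \<in> borel_measurable M"
    by (rule borel_measurable_LIMSEQ_metric[OF X_meas Y]) (simp add: spM)
  have emM: "emeasure M A = emeasure lborel A" if "A \<subseteq> \<Omega>" for A
    unfolding M_def by (rule emeasure_restrict_space) (use \<Omega> that in auto)
  define \<mu> where "\<mu> = distr M borel Y"
  have em\<mu>: "emeasure \<mu> A = emeasure lborel (Y -` A \<inter> \<Omega>)" if "A \<in> sets borel" for A
    unfolding \<mu>_def using that by (simp add: emeasure_distr spM emM)
  have em_sp: "emeasure \<mu> (space \<mu>) = ennreal (c E)"
    using em\<mu>[of UNIV] cE by (simp add: \<mu>_def \<Omega>_def)
  have fin: "finite_measure \<mu>" by (rule finite_measureI) (simp add: em_sp)
  interpret finite_measure \<mu> by (rule fin)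
  have "measure \<mu> (space \<mu>) = c E" using em_sp c0 by (simp add: measure_def)
  moreover have "AE x in \<mu>. x \<in> E"
    unfolding \<mu>_def using E Y_E by (subst AE_distr_iff) (auto simp: spM borel_compact)
  moreover have "\<exists>C\<ge>0. \<forall>p r. 0 < r \<longrightarrow> emeasure \<mu> (cball p r) \<le> ennreal (C * r powr t)"
  proof -
    obtain n0 where n0: "d / 2 ^ n0 \<le> \<delta>"
      using order_tendstoD(2)[OF d_lim \<delta>] by (auto simp: eventually_sequentially intro: less_imp_le)
    \<comment> \<open>\<open>N\<close> bounds the number of cells of level \<open>n\<close> meeting
      a ball of radius \<open>(1 + d) / 2 ^ n\<close>. \<open>C1\<close> serves radii above
      \<open>1 / 2 ^ n0\<close>, where the total mass is a sufficient bound, and \<open>C2\<close>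
      the smaller radii.\<close>
    define N where "N = (2 * (1 + d) + 1) ^ d"
    define C1 where "C1 = c E * (2 ^ n0) powr t"
    define C2 where "C2 = N * (2 * d) powr t"
    have "emeasure \<mu> (cball p r) \<le> ennreal ((C1 + C2) * r powr t)" if r: "0 < r" for p r
    proof (cases "1 / 2 ^ n0 < r")
      case True
      have "emeasure \<mu> (cball p r) \<le> ennreal (c E * 1)"
        using emeasure_space[of \<mu> "cball p r"] em_sp by simp
      also have "\<dots> \<le> ennreal (c E * (2 ^ n0 * r) powr t)"
        using True t c0 by (intro ennreal_leI mult_left_mono ge_one_powr_ge_zero) (auto simp: field_simps)
      also have "\<dots> \<le> ennreal ((C1 + C2) * r powr t)"
        by (intro ennreal_leI) (simp add: C1_def C2_def powr_mult algebra_simps)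
      finally show ?thesis .
    next
      case False
      \<comment> \<open>The level matching the radius:
        \<open>1 / 2 ^ Suc n < r \<le> 1 / 2 ^ n\<close>. Since \<open>r\<close> is at most
        \<open>1 / 2 ^ n0\<close>, it is at least \<open>n0\<close>, so \<open>c_cell\<close>
        applies.\<close>
      define n where "n = (LEAST n. 1 / 2 ^ Suc n < r)"
      have n1: "1 / 2 ^ Suc n < r"
      proof -
        have "(\<lambda>n. 1 / 2 ^ Suc n :: real) \<longlonglongrightarrow> 0"
          using LIMSEQ_Suc[OF LIMSEQ_divide_realpow_zero[of 2 1]] by simp
        then have "\<exists>n. 1 / 2 ^ Suc n < r"
          using order_tendstoD(2) r by (fastforce simp: eventually_sequentially)
        then show ?thesis unfolding n_def by (rule LeastI_ex)
      qed
      have n2: "n0 \<le> n"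
      proof (rule ccontr)
        assume "\<not> n0 \<le> n"
        then have "(2::real) ^ Suc n \<le> 2 ^ n0" by (intro power_increasing) auto
        then have "1 / 2 ^ n0 \<le> (1 / 2 ^ Suc n :: real)" by (intro divide_left_mono) auto
        then show False using n1 False by linarith
      qed
      have n3: "r \<le> 1 / 2 ^ n"
      proof (cases n)
        case 0
        have "1 / 2 ^ n0 \<le> (1::real)" by simp
        then have "r \<le> 1" using False by linarith
        then show ?thesis using 0 by simp
      next
        case (Suc j)
        then have "\<not> 1 / 2 ^ Suc j < r" unfolding n_def by (intro not_less_Least) simp
        then show ?thesis using Suc by simp
      qed
      have "(2::real) ^ n0 \<le> 2 ^ n" using n2 by (intro power_increasing) auto
      then have "d / 2 ^ n \<le> d / 2 ^ n0" by (intro divide_left_mono) auto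
      then have nd: "d / 2 ^ n \<le> \<delta>" using n0 by linarith
      \<comment> \<open>The enlarged radius absorbs both \<open>r \<le> 1 / 2 ^ n\<close> and the
        distance \<open>d / 2 ^ n\<close> between \<open>Y w\<close> and its approximation
        \<open>X n w\<close>.\<close>
      define A where "A = E \<inter> cball p ((1 + d) / 2 ^ n)"
      define J where "J = K n ` A"
      have gA: "finite (grid n ` A)" "card (grid n ` A) \<le> N"
      proof -
        have sub: "grid n ` A \<subseteq> grid n ` cball p (real (1 + d) / 2 ^ n)"
          by (auto simp: A_def)
        show "finite (grid n ` A)" "card (grid n ` A) \<le> N"
          using card_grid_cball[of n p "1 + d"] finite_subset[OF sub] card_mono[OF _ sub]
          by (auto simp: N_def d_def)
      qed
      have J: "finite J" "card J \<le> N"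
      proof -
        define h where "h g = K n (SOME x. x \<in> A \<and> grid n x = g)" for g
        have "K n x = h (grid n x)" if x: "x \<in> A" for x
        proof -
          have "(SOME z. z \<in> A \<and> grid n z = grid n x) \<in> A \<and> grid n (SOME z. z \<in> A \<and> grid n z = grid n x) = grid n x"
            by (rule someI[of _ x]) (use x in simp)
          then show ?thesis
            using grid_code_eq_iff[OF bE] x by (simp add: K_def h_def A_def)
        qed
        then have "J = h ` (grid n ` A)" by (auto simp: J_def image_image)
        then show "finite J" "card J \<le> N"
          using gA card_image_le[OF gA(1), of h] by auto
      qed
      \<comment> \<open>The mass of the ball is thereby at most the total length of at most
        \<open>N\<close> intervals, each no longer than the content of its cell.\<close>
      have sub: "Y -` cball p r \<inter> \<Omega> \<subseteq> (\<Union>k\<in>J. {F n k..<F n (Suc k)})"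
      proof
        fix w assume w: "w \<in> Y -` cball p r \<inter> \<Omega>"
        have "dist p (X n w) \<le> dist p (Y w) + dist (Y w) (X n w)" by (rule dist_triangle)
        also have "\<dots> \<le> 1 / 2 ^ n + d / 2 ^ n"
          using w Y_norm[of w n] n3 by (auto simp: dist_norm intro!: add_mono)
        finally have "X n w \<in> A"
          using w X(1)[of w n] by (simp add: A_def add_divide_distrib)
        then have "\<kappa> n w \<in> J" using X(2)[of w n] w by (auto simp: J_def intro!: image_eqI[of _ _ "X n w"])
        then show "w \<in> (\<Union>k\<in>J. {F n k..<F n (Suc k)})" using \<kappa>[of w n] w by auto
      qed
      have "emeasure \<mu> (cball p r) \<le> emeasure lborel (\<Union>k\<in>J. {F n k..<F n (Suc k)})"
        unfolding em\<mu>[OF borel_closed[OF closed_cball]]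
        by (rule emeasure_mono[OF sub]) (use J(1) in auto)
      also have "\<dots> \<le> (\<Sum>k\<in>J. emeasure lborel {F n k..<F n (Suc k)})"
        using J(1) by (intro emeasure_subadditive_finite) auto
      also have "\<dots> \<le> (\<Sum>k\<in>J. ennreal ((d / 2 ^ n) powr t))"
      proof (rule sum_mono)
        fix k
        have "F n (Suc k) - F n k \<le> (d / 2 ^ n) powr t"
          using F_Suc[of n k] c_cell[OF nd, of k] by linarith
        then show "emeasure lborel {F n k..<F n (Suc k)} \<le> ennreal ((d / 2 ^ n) powr t)"
          using F_mono[of k "Suc k" n] by (simp add: ennreal_leI)
      qed
      also have "\<dots> = ennreal (card J * (d / 2 ^ n) powr t)"
        by (simp add: ennreal_mult ennreal_of_nat_eq_real_of_nat)
      also have "\<dots> \<le> ennreal ((C1 + C2) * r powr t)"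
      proof (rule ennreal_leI)
        have "d / 2 ^ n \<le> 2 * d * r"
          using n1 d by (simp add: field_simps)
        then have "(d / 2 ^ n) powr t \<le> (2 * d * r) powr t"
          using t by (intro powr_mono2) auto
        then have "card J * (d / 2 ^ n) powr t \<le> N * (2 * d * r) powr t"
          using J(2) by (intro mult_mono) auto
        also have "\<dots> = C2 * r powr t" by (simp add: C2_def powr_mult)
        also have "\<dots> \<le> (C1 + C2) * r powr t"
          using c0 by (intro mult_right_mono) (auto simp: C1_def)
        finally show "card J * (d / 2 ^ n) powr t \<le> (C1 + C2) * r powr t" .
      qed
      finally show ?thesis .
    qed
    moreover have "0 \<le> C1 + C2" using c0 by (simp add: C1_def C2_def)
    ultimately show ?thesis by blast
  qed
  ultimately show ?thesis
    using fin cE by (intro exI[of _ \<mu>]) (auto simp: \<mu>_def)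
qed

subsection \<open>Gaussian energies\<close>

text \<open>This is the characteristic function of the standard normal distribution, freed from the
  normalisation of its density.\<close>

lemma gaussian_fourier_real:
  fixes w :: real
  shows "integrable lborel (\<lambda>x::real. exp (- x\<^sup>2 / 2) *\<^sub>R iexp (w * x))" (is ?I)
    and "(\<integral>x. exp (- x\<^sup>2 / 2) *\<^sub>R iexp (w * x) \<partial>lborel) = of_real (sqrt (2 * pi) * exp (- w\<^sup>2 / 2))" (is ?E)
proof -
  interpret real_distribution std_normal_distribution
    by (rule real_dist_normal_dist)
  have eq: "exp (- x\<^sup>2 / 2) *\<^sub>R iexp (w * x) = of_real (sqrt (2 * pi)) * (std_normal_density x *\<^sub>R iexp (w * x))" for x
    by (simp add: std_normal_density_def scaleR_conv_of_real)
  have "integrable std_normal_distribution (\<lambda>x. iexp (w * x))"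
    by (rule integrable_iexp) auto
  then have 1: "integrable lborel (\<lambda>x. std_normal_density x *\<^sub>R iexp (w * x))"
    by (subst (asm) integrable_density) auto
  then show ?I
    unfolding eq by (intro integrable_mult_right) auto
  have "(\<integral>x. std_normal_density x *\<^sub>R iexp (w * x) \<partial>lborel) = char std_normal_distribution w"
    unfolding char_def by (subst integral_density) auto
  then show ?E
    unfolding eq integral_mult_right_zero by (simp add: char_std_normal_distribution)
qed

text \<open>The complex exponential, unlike the cosine, factors over coordinates. The integral is
  therefore computed as a product of one-dimensional ones, and the real part is taken at the
  end.\<close>

lemma gaussian_fourier:
  fixes w :: "'a::euclidean_space"
  shows "integrable lborel (\<lambda>v::'a. exp (- (norm v)\<^sup>2 / 2) * cos (v \<bullet> w))" (is ?I)
    and "(\<integral>v. exp (- (norm v)\<^sup>2 / 2) * cos (v \<bullet> w) \<partial>lborel)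
           = sqrt (2 * pi) ^ DIM('a) * exp (- (norm w)\<^sup>2 / 2)" (is ?E)
proof -
  interpret product_sigma_finite "\<lambda>_::'a. lborel :: real measure" ..
  let ?f = "\<lambda>b x. exp (- x\<^sup>2 / 2) *\<^sub>R iexp ((w \<bullet> b) * x)"
  let ?g = "\<lambda>v::'a. \<Prod>b\<in>Basis. ?f b (v \<bullet> b)"
  let ?T = "\<lambda>f::'a \<Rightarrow> real. \<Sum>b\<in>Basis. f b *\<^sub>R b"
  have prod_exp: "(\<Prod>b\<in>Basis. exp (- (v \<bullet> b)\<^sup>2 / 2)) = exp (- (norm v)\<^sup>2 / 2)" for v :: 'a
  proof -
    have "(norm v)\<^sup>2 = (\<Sum>b\<in>Basis. (v \<bullet> b)\<^sup>2)"
      unfolding power2_norm_eq_inner by (subst euclidean_inner) (simp add: power2_eq_square)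
    then show ?thesis
      by (simp add: exp_sum[symmetric] sum_negf sum_divide_distrib)
  qed
  have comp: "?g (?T f) = (\<Prod>b\<in>Basis. ?f b (f b))" for f
    by (intro prod.cong) auto
  have int: "integrable lborel ?g"
    unfolding lborel_eq[where 'a='a]
    by (subst integrable_distr_eq, measurable)
       (simp only: comp, rule product_integrable_prod, simp, rule gaussian_fourier_real)
  have "integral\<^sup>L lborel ?g = (\<integral>f. (\<Prod>b\<in>Basis. ?f b (f b)) \<partial>(\<Pi>\<^sub>M b\<in>Basis. lborel))"
    by (subst lborel_eq, subst integral_distr) (auto simp: comp)
  also have "\<dots> = (\<Prod>b\<in>Basis. integral\<^sup>L lborel (?f b))"
    by (rule product_integral_prod, simp, rule gaussian_fourier_real)
  also have "\<dots> = (\<Prod>b\<in>(Basis::'a set). of_real (sqrt (2 * pi) * exp (- (w \<bullet> b)\<^sup>2 / 2)))"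
    by (simp only: gaussian_fourier_real)
  also have "\<dots> = of_real (sqrt (2 * pi) ^ DIM('a) * (\<Prod>b\<in>(Basis::'a set). exp (- (w \<bullet> b)\<^sup>2 / 2)))"
    by (simp only: of_real_prod[symmetric] prod.distrib prod_constant)
  also have "(\<Prod>b\<in>(Basis::'a set). exp (- (w \<bullet> b)\<^sup>2 / 2)) = exp (- (norm w)\<^sup>2 / 2)"
    by (rule prod_exp)
  finally have eq: "integral\<^sup>L lborel ?g = of_real (sqrt (2 * pi) ^ DIM('a) * exp (- (norm w)\<^sup>2 / 2))" .
  have Re: "Re (?g v) = exp (- (norm v)\<^sup>2 / 2) * cos (v \<bullet> w)" for v
  proof -
    have "?g v = of_real (\<Prod>b\<in>Basis. exp (- (v \<bullet> b)\<^sup>2 / 2)) * exp (\<Sum>b\<in>Basis. \<i> * of_real ((w \<bullet> b) * (v \<bullet> b)))"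
      by (simp add: scaleR_conv_of_real prod.distrib exp_sum)
    also have "(\<Prod>b\<in>Basis. exp (- (v \<bullet> b)\<^sup>2 / 2)) = exp (- (norm v)\<^sup>2 / 2)"
      by (rule prod_exp)
    also have "(\<Sum>b\<in>Basis. \<i> * of_real ((w \<bullet> b) * (v \<bullet> b))) = \<i> * of_real (v \<bullet> w)"
      by (simp add: sum_distrib_left[symmetric] euclidean_inner[of v w] mult.commute)
    also have "exp (\<i> * of_real (v \<bullet> w)) = cis (v \<bullet> w)"
      by (simp add: cis_conv_exp)
    finally show ?thesis by simp
  qed
  show ?I
    using integrable_Re[OF int] by (simp only: Re)
  show ?E
    using integral_Re[OF int] by (simp only: Re eq) simp
qed

text \<open>The squared modulus of the Fourier transform of \<open>\<mu>\<close>, in real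
  terms.\<close>

definition fourier_energy :: "'a::euclidean_space measure \<Rightarrow> 'a \<Rightarrow> real" where
  "fourier_energy \<mu> \<xi> = (\<integral>y. cos (\<xi> \<bullet> y) \<partial>\<mu>)\<^sup>2 + (\<integral>y. sin (\<xi> \<bullet> y) \<partial>\<mu>)\<^sup>2"

lemma fourier_energy_nonneg: "0 \<le> fourier_energy \<mu> \<xi>"
  by (simp add: fourier_energy_def)

lemma measurable_fourier_energy [measurable]:
  fixes \<mu> :: "'a::euclidean_space measure"
  assumes "finite_measure \<mu>" and [measurable_cong]: "sets \<mu> = sets borel"
  shows "fourier_energy \<mu> \<in> borel_measurable borel"
proof -
  interpret finite_measure \<mu> by fact
  show ?thesis
    unfolding fourier_energy_def by measurable
qed

lemma fourier_energy_eq: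
  fixes \<mu> :: "'a::euclidean_space measure"
  assumes "finite_measure \<mu>" and [measurable_cong]: "sets \<mu> = sets borel"
  shows "(\<integral>p. cos (\<xi> \<bullet> (fst p - snd p)) \<partial>(\<mu> \<Otimes>\<^sub>M \<mu>)) = fourier_energy \<mu> \<xi>"
proof -
  interpret finite_measure \<mu> by fact
  interpret pair_sigma_finite \<mu> \<mu> ..
  interpret P: finite_measure "\<mu> \<Otimes>\<^sub>M \<mu>"
    by (rule finite_measure_pair_measure) fact+
  have [simp]: "integrable \<mu> (\<lambda>y. cos (\<xi> \<bullet> y))" "integrable \<mu> (\<lambda>y. sin (\<xi> \<bullet> y))"
    by (rule integrable_const_bound[where B=1]; simp)+
  have "integrable (\<mu> \<Otimes>\<^sub>M \<mu>) (\<lambda>p. cos (\<xi> \<bullet> (fst p - snd p)))"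
    by (rule P.integrable_const_bound[where B=1]) auto
  then have "(\<integral>p. cos (\<xi> \<bullet> (fst p - snd p)) \<partial>(\<mu> \<Otimes>\<^sub>M \<mu>)) = (\<integral>y. \<integral>z. cos (\<xi> \<bullet> (y - z)) \<partial>\<mu> \<partial>\<mu>)"
    by (subst integral_fst'[symmetric]) auto
  also have "\<dots> = fourier_energy \<mu> \<xi>"
    by (simp add: inner_diff_right cos_diff fourier_energy_def power2_eq_square)
  finally show ?thesis .
qed

text \<open>Applied with \<open>'b = 'a\<close> and a dilation \<open>L\<close>, and with \<open>'b = real \<times> 'a\<close> and \<open>L (r, v) = v + c r x\<close>; the latter
  makes the anisotropic kernel of the slab energy below isotropic in one more dimension.\<close>

lemma gaussian_energy_eq:
  fixes \<mu> :: "'a::euclidean_space measure" and L :: "'b::euclidean_space \<Rightarrow> 'a"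
  assumes "finite_measure \<mu>" and [measurable_cong]: "sets \<mu> = sets borel"
    and [measurable]: "L \<in> borel_measurable borel" "L' \<in> borel_measurable borel"
    and adj: "\<And>v w. L v \<bullet> w = v \<bullet> L' w"
  shows "ennreal (sqrt (2 * pi) ^ DIM('b)) *
           (\<integral>\<^sup>+p. ennreal (exp (- (norm (L' (fst p - snd p)))\<^sup>2 / 2)) \<partial>(\<mu> \<Otimes>\<^sub>M \<mu>))
       = (\<integral>\<^sup>+v. ennreal (exp (- (norm v)\<^sup>2 / 2)) * ennreal (fourier_energy \<mu> (L v)) \<partial>lborel)"
proof -
  interpret finite_measure \<mu> by fact
  interpret P: finite_measure "\<mu> \<Otimes>\<^sub>M \<mu>"
    by (rule finite_measure_pair_measure) fact+
  interpret PL: pair_sigma_finite "\<mu> \<Otimes>\<^sub>M \<mu>" "lborel :: 'b measure" ..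
  let ?c = "sqrt (2 * pi) ^ DIM('b)"
  let ?f = "\<lambda>p v. exp (- (norm v)\<^sup>2 / 2) * cos (L v \<bullet> (fst p - snd p))"
  have g: "integrable lborel (\<lambda>v::'b. exp (- (norm v)\<^sup>2 / 2))"
    using gaussian_fourier(1)[of "0::'b"] by simp
  \<comment> \<open>Fubini is justified by domination: the integrand is at most a Gaussian in
    \<open>v\<close>, and the product measure in \<open>p\<close> is finite.\<close>
  have int: "integrable ((\<mu> \<Otimes>\<^sub>M \<mu>) \<Otimes>\<^sub>M lborel) (case_prod ?f)"
  proof (rule PL.Fubini_integrable)
    show "AE p in \<mu> \<Otimes>\<^sub>M \<mu>. integrable lborel (\<lambda>v. case_prod ?f (p, v))"
      unfolding adj by (simp only: prod.case) (intro always_eventually allI gaussian_fourier)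
    have "norm (\<integral>v. norm (?f p v) \<partial>lborel) \<le> (\<integral>v. exp (- (norm (v::'b))\<^sup>2 / 2) \<partial>lborel)" for p
    proof -
      have "integrable lborel (?f p)"
        unfolding adj by (rule gaussian_fourier)
      moreover have "norm (?f p v) \<le> exp (- (norm v)\<^sup>2 / 2)" for v
        by (simp add: abs_mult mult_left_le)
      ultimately show ?thesis
        using integral_mono[OF integrable_norm g, of "?f p"] by simp
    qed
    then show "integrable (\<mu> \<Otimes>\<^sub>M \<mu>) (\<lambda>p. \<integral>v. norm (case_prod ?f (p, v)) \<partial>lborel)"
      by (intro P.integrable_const_bound[where B="\<integral>v. exp (- (norm (v::'b))\<^sup>2 / 2) \<partial>lborel"]) auto
  qed simp
  have 1: "(\<integral>v. ?f p v \<partial>lborel) = ?c * exp (- (norm (L' (fst p - snd p)))\<^sup>2 / 2)" for p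
    unfolding adj by (rule gaussian_fourier)
  have 2: "(\<integral>p. ?f p v \<partial>(\<mu> \<Otimes>\<^sub>M \<mu>)) = exp (- (norm v)\<^sup>2 / 2) * fourier_energy \<mu> (L v)" for v
    by (simp add: fourier_energy_eq[OF assms(1,2)])
  \<comment> \<open>The integrand changes sign, but both inner integrals are nonnegative; this lets
    the Fubini identity for Bochner integrals be restated with nonnegative integrals.\<close>
  have 3: "0 \<le> (\<integral>v. ?f p v \<partial>lborel)" for p
    unfolding 1 by simp
  have 4: "0 \<le> (\<integral>p. ?f p v \<partial>(\<mu> \<Otimes>\<^sub>M \<mu>))" for v
    unfolding 2 by (simp add: fourier_energy_nonneg)
  have "ennreal ?c * (\<integral>\<^sup>+p. ennreal (exp (- (norm (L' (fst p - snd p)))\<^sup>2 / 2)) \<partial>(\<mu> \<Otimes>\<^sub>M \<mu>))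
      = (\<integral>\<^sup>+p. ennreal (\<integral>v. ?f p v \<partial>lborel) \<partial>(\<mu> \<Otimes>\<^sub>M \<mu>))"
    unfolding 1 by (simp add: ennreal_mult nn_integral_cmult)
  also have "\<dots> = ennreal (\<integral>p. \<integral>v. ?f p v \<partial>lborel \<partial>(\<mu> \<Otimes>\<^sub>M \<mu>))"
    using PL.integrable_fst[OF int] by (intro nn_integral_eq_integral AE_I2 3)
  also have "\<dots> = ennreal (\<integral>v. \<integral>p. ?f p v \<partial>(\<mu> \<Otimes>\<^sub>M \<mu>) \<partial>lborel)"
    by (simp only: PL.Fubini_integral[OF int])
  also have "\<dots> = (\<integral>\<^sup>+v. ennreal (\<integral>p. ?f p v \<partial>(\<mu> \<Otimes>\<^sub>M \<mu>)) \<partial>lborel)"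
    using PL.integrable_snd[OF int]
    by (intro nn_integral_eq_integral[symmetric] AE_I2 4)
  also have "\<dots> = (\<integral>\<^sup>+v. ennreal (exp (- (norm v)\<^sup>2 / 2)) * ennreal (fourier_energy \<mu> (L v)) \<partial>lborel)"
    unfolding 2 by (simp add: ennreal_mult fourier_energy_nonneg)
  finally show ?thesis .
qed

section \<open>The Frostman condition tested against Gaussians\<close>

lemma summable_exp_powr: "summable (\<lambda>k::nat. exp (- real k) * (real k + 1) powr t)"
proof (rule summable_comparison_test_bigo)
  show "summable (\<lambda>k. norm (exp (- 1 / 2 :: real) ^ k))"
    by (simp add: summable_geometric)
  have "(\<lambda>k::nat. exp (- real k) * (real k + 1) powr t) \<in> O(\<lambda>k. exp (- real k / 2))"
    by real_asymp
  moreover have "exp (- real k / 2) = exp (- 1 / 2) ^ k" for k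
    using exp_of_nat_mult[of k "- 1 / 2 :: real"] by simp
  ultimately show "(\<lambda>k::nat. exp (- real k) * (real k + 1) powr t) \<in> O(\<lambda>k. exp (- 1 / 2 :: real) ^ k)"
    by simp
qed

text \<open>Space is divided by distance from \<open>x0\<close> in units of \<open>1 / l\<close>.
  Where \<open>l * norm (x - x0)\<close> has integer part \<open>k\<close>, the kernel is at most
  \<open>exp (- k)\<close>, and the ball of radius \<open>(k + 1) / l\<close> has mass at most
  \<open>C * ((k + 1) / l) powr t\<close>; the resulting series converges.\<close>

lemma frostman_gaussian:
  fixes \<mu> :: "'a::euclidean_space measure"
  assumes [measurable_cong]: "sets \<mu> = sets borel"
    and frost: "\<And>x r. 0 < r \<Longrightarrow> emeasure \<mu> (cball x r) \<le> ennreal (C * r powr t)"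
    and "0 \<le> C"
  shows "\<exists>A\<ge>0. \<forall>x0 l. 0 < l \<longrightarrow>
      (\<integral>\<^sup>+x. ennreal (exp (- (l * norm (x - x0))\<^sup>2)) \<partial>\<mu>) \<le> ennreal (A * l powr - t)"
proof (intro exI conjI allI impI)
  let ?S = "\<Sum>k::nat. exp (- real k) * (real k + 1) powr t"
  show "0 \<le> C * ?S"
    using \<open>0 \<le> C\<close> by (intro mult_nonneg_nonneg suminf_nonneg summable_exp_powr) auto
  fix x0 :: 'a and l :: real assume l: "0 < l"
  let ?B = "\<lambda>k::nat. cball x0 ((real k + 1) / l)"
  have [measurable]: "?B k \<in> sets \<mu>" for k
    by (simp add: assms(1))
  have pw: "ennreal (exp (- (l * norm (x - x0))\<^sup>2)) \<le> (\<Sum>k. ennreal (exp (- real k)) * indicator (?B k) x)" for x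
  proof -
    define v where "v = l * norm (x - x0)"
    define k where "k = nat \<lfloor>v\<rfloor>"
    have v: "0 \<le> v" using l by (simp add: v_def)
    have k: "real k \<le> v" "v \<le> real k + 1"
      using v unfolding k_def by linarith+
    have "x \<in> ?B k"
      using k(2) l by (simp add: v_def dist_norm norm_minus_commute field_simps)
    moreover have "real k \<le> v\<^sup>2"
    proof -
      have "real k \<le> real k ^ 2" by (cases k) (auto simp: power2_eq_square)
      also have "\<dots> \<le> v\<^sup>2" using k by (intro power_mono) auto
      finally show ?thesis .
    qed
    ultimately have "ennreal (exp (- v\<^sup>2)) \<le> ennreal (exp (- real k)) * indicator (?B k) x"
      by (simp add: ennreal_leI)
    also have "\<dots> \<le> (\<Sum>k. ennreal (exp (- real k)) * indicator (?B k) x)"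
      using sum_le_suminf[OF summableI, of "{k}"] by auto
    finally show ?thesis by (simp add: v_def)
  qed
  have "(\<integral>\<^sup>+x. ennreal (exp (- (l * norm (x - x0))\<^sup>2)) \<partial>\<mu>)
      \<le> (\<integral>\<^sup>+x. (\<Sum>k. ennreal (exp (- real k)) * indicator (?B k) x) \<partial>\<mu>)"
    by (rule nn_integral_mono) (rule pw)
  also have "\<dots> = (\<Sum>k. \<integral>\<^sup>+x. ennreal (exp (- real k)) * indicator (?B k) x \<partial>\<mu>)"
    by (rule nn_integral_suminf) measurable
  also have "\<dots> = (\<Sum>k. ennreal (exp (- real k)) * emeasure \<mu> (?B k))"
    by (simp add: nn_integral_cmult_indicator assms(1))
  also have "\<dots> \<le> (\<Sum>k. ennreal (C * l powr - t * (exp (- real k) * (real k + 1) powr t)))"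
  proof (intro suminf_le summableI)
    fix k
    have "ennreal (exp (- real k)) * emeasure \<mu> (?B k)
        \<le> ennreal (exp (- real k)) * ennreal (C * ((real k + 1) / l) powr t)"
      using l by (intro mult_left_mono frost) auto
    also have "\<dots> = ennreal (C * l powr - t * (exp (- real k) * (real k + 1) powr t))"
      using l \<open>0 \<le> C\<close> by (simp add: ennreal_mult[symmetric] powr_divide powr_minus field_simps)
    finally show "ennreal (exp (- real k)) * emeasure \<mu> (?B k)
        \<le> ennreal (C * l powr - t * (exp (- real k) * (real k + 1) powr t))" .
  qed
  also have "\<dots> = ennreal (\<Sum>k. C * l powr - t * (exp (- real k) * (real k + 1) powr t))"
    using \<open>0 \<le> C\<close> by (intro suminf_ennreal2 summable_mult summable_exp_powr) auto
  also have "\<dots> = ennreal (C * ?S * l powr - t)"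
    by (subst suminf_mult[OF summable_exp_powr]) (simp add: mult_ac)
  finally show "(\<integral>\<^sup>+x. ennreal (exp (- (l * norm (x - x0))\<^sup>2)) \<partial>\<mu>) \<le> ennreal (C * ?S * l powr - t)" .
qed

section \<open>Rays through the origin\<close>

text \<open>Pythagoras, with \<open>p *\<^sub>R x\<close> the orthogonal projection of
  \<open>\<xi>\<close> to the line spanned by \<open>x\<close>.\<close>

lemma norm_diff_line_sq:
  fixes \<xi> x :: "'a::real_inner"
  assumes "x \<noteq> 0"
  defines "p \<equiv> (\<xi> \<bullet> x) / (x \<bullet> x)"
  shows "(norm (\<xi> - r *\<^sub>R x))\<^sup>2 = (norm (\<xi> - p *\<^sub>R x))\<^sup>2 + (norm x * (r - p))\<^sup>2"
proof -
  have e: "(norm (\<xi> - s *\<^sub>R x))\<^sup>2 = \<xi> \<bullet> \<xi> - 2 * s * (\<xi> \<bullet> x) + s\<^sup>2 * (x \<bullet> x)" for s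
    unfolding power2_norm_eq_inner
    by (simp add: inner_diff_left inner_diff_right inner_commute[of x \<xi>] power2_eq_square algebra_simps)
  have "\<xi> \<bullet> x = p * (x \<bullet> x)" using assms by (simp add: p_def)
  then show ?thesis
    unfolding e power_mult_distrib power2_norm_eq_inner[of x]
    by (simp only:) (simp add: algebra_simps power2_eq_square)
qed

text \<open>Assumption \<open>T\<close> says that \<open>P\<close> meets the lines through the origin transversally: nearby points of \<open>P\<close>
  have directions separated by a comparable amount.\<close>

lemma ray_distance_lower_bound:
  fixes P :: "'a::euclidean_space set"
  assumes P: "compact P" "P \<noteq> {}" and B: "\<And>x. x \<in> P \<Longrightarrow> norm x \<le> B" "0 \<notin> P"
    and C: "1 \<le> C" and T: "\<And>x x0 s. x \<in> P \<Longrightarrow> x0 \<in> P \<Longrightarrow> norm (x - x0) \<le> C * norm (x0 - s *\<^sub>R x)"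
  shows "\<exists>x0\<in>P. \<forall>x\<in>P. \<forall>r. norm \<xi> * norm (x - x0) \<le> 4 * B * C * norm (\<xi> - r *\<^sub>R x)"
proof -
  define p where "p x = (\<xi> \<bullet> x) / (x \<bullet> x)" for x
  \<comment> \<open>\<open>x0\<close> is taken to span the line nearest to \<open>\<xi>\<close>, so
    its distance from \<open>\<xi>\<close> is at most \<open>norm (\<xi> - r *\<^sub>R x)\<close>
    for every competing \<open>x\<close> and \<open>r\<close>.\<close>
  have "continuous_on P (\<lambda>x. norm (\<xi> - p x *\<^sub>R x))"
    unfolding p_def using B(2) by (intro continuous_intros) auto
  from continuous_attains_inf[OF P this]
  obtain x0 where x0: "x0 \<in> P" "\<And>x. x \<in> P \<Longrightarrow> norm (\<xi> - p x0 *\<^sub>R x0) \<le> norm (\<xi> - p x *\<^sub>R x)"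
    by blast
  have "norm \<xi> * norm (x - x0) \<le> 4 * B * C * norm (\<xi> - r *\<^sub>R x)" if x: "x \<in> P" for x r
  proof -
    define D where "D = norm (\<xi> - r *\<^sub>R x)"
    have "x \<noteq> 0" using x B(2) by auto
    then have "(norm (\<xi> - p x *\<^sub>R x))\<^sup>2 \<le> D\<^sup>2"
      unfolding D_def p_def norm_diff_line_sq[OF \<open>x \<noteq> 0\<close>, of \<xi> r] by simp
    then have "norm (\<xi> - p x *\<^sub>R x) \<le> D"
      by (simp add: D_def)
    then have w0: "norm (\<xi> - p x0 *\<^sub>R x0) \<le> D"
      using x0(2)[OF x] by linarith
    have D0: "0 \<le> D" by (simp add: D_def)
    have B0: "0 \<le> B" using B(1)[OF x] norm_ge_zero order_trans by blast
    show ?thesis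
    \<comment> \<open>If \<open>\<xi>\<close> is far from the ray relative to its length, the
      diameter bound \<open>2 * B\<close> is enough. Otherwise \<open>\<bar>p x0\<bar>\<close> is at
      least \<open>norm \<xi> / (2 * B)\<close>, and dividing by \<open>p x0\<close> brings the
      situation to the scale of \<open>P\<close>, where \<open>T\<close> applies.\<close>
    proof (cases "norm \<xi> \<le> 2 * D")
      case True
      have "norm (x - x0) \<le> 2 * B"
        using norm_triangle_ineq4[of x x0] B(1)[OF x] B(1)[OF x0(1)] by linarith
      then have "norm \<xi> * norm (x - x0) \<le> (2 * D) * (2 * B)"
        using True D0 by (intro mult_mono) auto
      also have "\<dots> = 4 * B * D * 1" by simp
      also have "\<dots> \<le> 4 * B * D * C"
        using C D0 B0 by (intro mult_left_mono) auto
      finally show ?thesis by (simp add: D_def mult_ac)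
    next
      case False
      have "norm \<xi> \<le> norm (\<xi> - p x0 *\<^sub>R x0) + norm (p x0 *\<^sub>R x0)"
        by (metis diff_add_cancel norm_triangle_ineq)
      then have "norm \<xi> \<le> 2 * (\<bar>p x0\<bar> * norm x0)"
        using False w0 by simp
      also have "\<dots> \<le> 2 * (\<bar>p x0\<bar> * B)"
        using B(1)[OF x0(1)] by (intro mult_left_mono) auto
      finally have p0: "norm \<xi> \<le> 2 * B * \<bar>p x0\<bar>" by (simp add: mult_ac)
      then have "p x0 \<noteq> 0" using False D0 by auto
      then have "\<bar>p x0\<bar> * norm (x0 - (r / p x0) *\<^sub>R x) = norm (p x0 *\<^sub>R x0 - r *\<^sub>R x)"
        by (simp add: scaleR_diff_right flip: norm_scaleR)
      also have "\<dots> = norm ((\<xi> - r *\<^sub>R x) - (\<xi> - p x0 *\<^sub>R x0))"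
        by simp
      also have "\<dots> \<le> 2 * D"
        using norm_triangle_ineq4[of "\<xi> - r *\<^sub>R x" "\<xi> - p x0 *\<^sub>R x0"] w0 by (simp add: D_def)
      finally have *: "\<bar>p x0\<bar> * norm (x0 - (r / p x0) *\<^sub>R x) \<le> 2 * D" .
      have "norm \<xi> * norm (x - x0) \<le> (2 * B * \<bar>p x0\<bar>) * (C * norm (x0 - (r / p x0) *\<^sub>R x))"
        using p0 T[OF x x0(1)] B0 by (intro mult_mono) auto
      also have "\<dots> = (2 * B * C) * (\<bar>p x0\<bar> * norm (x0 - (r / p x0) *\<^sub>R x))"
        by simp
      also have "\<dots> \<le> (2 * B * C) * (2 * D)"
        using * B0 C by (intro mult_left_mono) auto
      finally show ?thesis by (simp add: D_def)
    qed
  qed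
  then show ?thesis using x0(1) by blast
qed

lemma nn_integral_gaussian:
  "(\<integral>\<^sup>+v. ennreal (exp (- (norm (v :: 'a::euclidean_space))\<^sup>2 / 2)) \<partial>lborel)
     = ennreal (sqrt (2 * pi) ^ DIM('a))"
proof -
  have "integrable lborel (\<lambda>v::'a. exp (- (norm v)\<^sup>2 / 2))"
    using gaussian_fourier(1)[of "0::'a"] by simp
  then have "(\<integral>\<^sup>+v. ennreal (exp (- (norm (v :: 'a))\<^sup>2 / 2)) \<partial>lborel)
      = ennreal (\<integral>v. exp (- (norm (v :: 'a))\<^sup>2 / 2) \<partial>lborel)"
    by (rule nn_integral_eq_integral) simp
  then show ?thesis
    using gaussian_fourier(2)[of "0::'a"] by simp
qed

lemma nn_integral_gaussian_line:
  fixes c p :: real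
  assumes "0 < c"
  shows "(\<integral>\<^sup>+r. ennreal (exp (- (c * (r - p))\<^sup>2 / 2)) \<partial>lborel) = ennreal (sqrt (2 * pi) / c)"
proof -
  have "(\<integral>\<^sup>+r. ennreal (exp (- (c * (r - p))\<^sup>2 / 2)) \<partial>lborel)
      = \<bar>1 / c\<bar> * (\<integral>\<^sup>+r. ennreal (exp (- (c * (p + (1 / c) * r - p))\<^sup>2 / 2)) \<partial>lborel)"
    using assms by (intro nn_integral_real_affine) auto
  also have "(\<integral>\<^sup>+r. ennreal (exp (- (c * (p + (1 / c) * r - p))\<^sup>2 / 2)) \<partial>lborel) = ennreal (sqrt (2 * pi))"
    using assms nn_integral_gaussian[where 'a=real] by simp
  finally show ?thesis
    using assms by (simp add: ennreal_mult[symmetric])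
qed

text \<open>The left side is the cone weight, bounded for small \<open>\<xi>\<close> and of order
  \<open>norm \<xi> powr - t\<close> for large \<open>\<xi>\<close>. Majorising it by a dyadic sum
  of Gaussians lets the later integration against the Fourier energy be done one scale at a
  time.\<close>

lemma frostman_ray_integral:
  fixes \<mu> :: "'a::euclidean_space measure"
  assumes "finite_measure \<mu>" and [measurable_cong]: "sets \<mu> = sets borel"
    and supp: "AE x in \<mu>. x \<in> P"
    and P: "compact P" "P \<noteq> {}" "0 \<notin> P"
    and T: "\<And>x x0 s. x \<in> P \<Longrightarrow> x0 \<in> P \<Longrightarrow> norm (x - x0) \<le> C * norm (x0 - s *\<^sub>R x)" "1 \<le> C"
    and G: "\<And>x0 l. 0 < l \<Longrightarrow>
      (\<integral>\<^sup>+x. ennreal (exp (- (l * norm (x - x0))\<^sup>2)) \<partial>\<mu>) \<le> ennreal (A * l powr - t)"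
    and "0 \<le> A" "0 \<le> t"
  shows "\<exists>K\<ge>0. \<forall>\<xi>. (\<integral>\<^sup>+x. \<integral>\<^sup>+r. ennreal (exp (- (norm (\<xi> - r *\<^sub>R x))\<^sup>2 / 2)) \<partial>lborel \<partial>\<mu>)
      \<le> ennreal K * (\<Sum>k. ennreal (2 powr (- t * real k)) * ennreal (exp (- (norm \<xi> / 2 ^ k)\<^sup>2 / 2)))"
proof -
  interpret finite_measure \<mu> by fact
  obtain \<rho> where \<rho>: "0 < \<rho>" "\<And>x. x \<in> P \<Longrightarrow> \<rho> \<le> norm x"
  proof -
    obtain x1 where "x1 \<in> P" "\<And>x. x \<in> P \<Longrightarrow> norm x1 \<le> norm x"
      using continuous_attains_inf[OF P(1,2) continuous_on_norm_id] by blast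
    then show thesis using that[of "norm x1"] P(3) by force
  qed
  obtain B where B: "0 < B" "\<And>x. x \<in> P \<Longrightarrow> norm x \<le> B"
    using compact_imp_bounded[OF P(1)] bounded_pos by metis
  define m where "m = measure \<mu> (space \<mu>)"
  define c where "c = sqrt (2 * pi) / \<rho>"
  define \<kappa> where "\<kappa> = 1 / (4 * B * C)"
  \<comment> \<open>The first summand is for \<open>norm \<xi> \<le> 1\<close>, the second for
    larger \<open>\<xi>\<close>; its factor \<open>2 powr t\<close> comes from comparing
    \<open>norm \<xi>\<close> with the lower end of its dyadic range.\<close>
  define K where "K = (c * m + c * A * (\<kappa> / sqrt 2) powr - t * 2 powr t)"
  have pos: "0 \<le> m" "0 < c" "0 < \<kappa>"
    using \<rho> B T(2) by (auto simp: m_def c_def \<kappa>_def)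
  have K: "0 \<le> K"
    using pos \<open>0 \<le> A\<close> by (simp add: K_def)
  \<comment> \<open>If the whole line stays at distance \<open>D\<close> from \<open>\<xi>\<close>,
    Pythagoras splits off \<open>exp (- D\<^sup>2 / 2)\<close> and leaves a one-dimensional Gaussian
    in \<open>r\<close>, whose integral is at most \<open>c\<close> because
    \<open>norm x \<ge> \<rho>\<close>.\<close>
  have inner: "(\<integral>\<^sup>+r. ennreal (exp (- (norm (\<xi> - r *\<^sub>R x))\<^sup>2 / 2)) \<partial>lborel) \<le> ennreal (c * exp (- D\<^sup>2 / 2))"
    if x: "x \<in> P" and D: "0 \<le> D" "\<And>r. D \<le> norm (\<xi> - r *\<^sub>R x)" for x D \<xi>
  proof -
    have x0: "x \<noteq> 0" "0 < norm x" using x P(3) by auto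
    let ?p = "(\<xi> \<bullet> x) / (x \<bullet> x)"
    have le: "exp (- (norm (\<xi> - r *\<^sub>R x))\<^sup>2 / 2) \<le> exp (- D\<^sup>2 / 2) * exp (- (norm x * (r - ?p))\<^sup>2 / 2)" for r
    proof -
      have "D\<^sup>2 \<le> (norm (\<xi> - ?p *\<^sub>R x))\<^sup>2"
        using D by (intro power_mono) auto
      then show ?thesis
        unfolding norm_diff_line_sq[OF x0(1), of \<xi> r] exp_add[symmetric] by (simp add: field_simps)
    qed
    have "(\<integral>\<^sup>+r. ennreal (exp (- (norm (\<xi> - r *\<^sub>R x))\<^sup>2 / 2)) \<partial>lborel)
        \<le> (\<integral>\<^sup>+r. ennreal (exp (- D\<^sup>2 / 2)) * ennreal (exp (- (norm x * (r - ?p))\<^sup>2 / 2)) \<partial>lborel)"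
      unfolding ennreal_mult[OF exp_ge_zero exp_ge_zero, symmetric]
      by (intro nn_integral_mono ennreal_leI le)
    also have "\<dots> = ennreal (exp (- D\<^sup>2 / 2)) * ennreal (sqrt (2 * pi) / norm x)"
      by (subst nn_integral_cmult) (use nn_integral_gaussian_line[OF x0(2)] in auto)
    also have "\<dots> \<le> ennreal (exp (- D\<^sup>2 / 2)) * ennreal c"
      unfolding c_def using \<rho>(2)[OF x] \<rho>(1) x0(2)
      by (intro mult_left_mono ennreal_leI divide_left_mono mult_pos_pos) auto
    finally show ?thesis
      using pos(2) by (simp add: ennreal_mult[symmetric] mult.commute)
  qed
  have "(\<integral>\<^sup>+x. \<integral>\<^sup>+r. ennreal (exp (- (norm (\<xi> - r *\<^sub>R x))\<^sup>2 / 2)) \<partial>lborel \<partial>\<mu>)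
      \<le> ennreal (K * exp (1 / 2)) * (\<Sum>k. ennreal (2 powr (- t * real k)) * ennreal (exp (- (norm \<xi> / 2 ^ k)\<^sup>2 / 2)))"
    (is "?M \<le> _") for \<xi>
  proof -
    have ex: "\<exists>k::nat. norm \<xi> \<le> 2 ^ k"
      using real_arch_pow[of 2 "norm \<xi>"] by (auto intro: less_imp_le)
    \<comment> \<open>The dyadic scale of \<open>\<xi>\<close>. Of the whole sum on the right only
      this term is used.\<close>
    define k where "k = (LEAST k::nat. norm \<xi> \<le> 2 ^ k)"
    have k: "norm \<xi> \<le> 2 ^ k"
      unfolding k_def using ex by (rule LeastI_ex)
    have "?M \<le> ennreal (K * 2 powr (- t * real k))"
    proof (cases k)
      case 0
      have "?M \<le> (\<integral>\<^sup>+x. ennreal c \<partial>\<mu>)"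
        by (intro nn_integral_mono_AE eventually_mono[OF supp]) (use inner[where D=0] in auto)
      also have "\<dots> = ennreal (c * m)"
        using pos by (simp add: emeasure_eq_measure m_def ennreal_mult)
      also have "\<dots> \<le> ennreal (K * 2 powr (- t * real k))"
        using 0 pos \<open>0 \<le> A\<close> by (intro ennreal_leI) (simp add: K_def)
      finally show ?thesis .
    next
      case (Suc j)
      have j: "2 ^ j < norm \<xi>"
        using not_less_Least[of j "\<lambda>k. norm \<xi> \<le> 2 ^ k"] Suc unfolding k_def[symmetric] by simp
      have \<xi>0: "0 < norm \<xi>"
        using j by (meson less_trans zero_less_numeral zero_less_power)
      obtain x0 where x0: "\<And>x r. x \<in> P \<Longrightarrow> norm \<xi> * norm (x - x0) \<le> 4 * B * C * norm (\<xi> - r *\<^sub>R x)"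
        using ray_distance_lower_bound[OF P(1,2) B(2) P(3) T(2,1), of \<xi>] by blast
      \<comment> \<open>The division by \<open>sqrt 2\<close> converts the exponent with
        \<open>/ 2\<close> into the form required by \<open>G\<close>.\<close>
      define l where "l = \<kappa> / sqrt 2 * norm \<xi>"
      have l: "0 < l" using pos \<xi>0 by (simp add: l_def)
      have "?M \<le> (\<integral>\<^sup>+x. ennreal c * ennreal (exp (- (l * norm (x - x0))\<^sup>2)) \<partial>\<mu>)"
      proof (intro nn_integral_mono_AE eventually_mono[OF supp])
        fix x assume x: "x \<in> P"
        have "\<kappa> * (norm \<xi> * norm (x - x0)) \<le> norm (\<xi> - r *\<^sub>R x)" for r
          using x0[OF x, of r] B(1) T(2) by (simp add: \<kappa>_def field_simps)
        then have "(\<integral>\<^sup>+r. ennreal (exp (- (norm (\<xi> - r *\<^sub>R x))\<^sup>2 / 2)) \<partial>lborel)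
            \<le> ennreal (c * exp (- (\<kappa> * (norm \<xi> * norm (x - x0)))\<^sup>2 / 2))"
          using pos by (intro inner[OF x]) auto
        also have "(\<kappa> * (norm \<xi> * norm (x - x0)))\<^sup>2 / 2 = (l * norm (x - x0))\<^sup>2"
          by (simp add: l_def power_mult_distrib power_divide)
        then have "- (\<kappa> * (norm \<xi> * norm (x - x0)))\<^sup>2 / 2 = - (l * norm (x - x0))\<^sup>2"
          by simp
        finally show "(\<integral>\<^sup>+r. ennreal (exp (- (norm (\<xi> - r *\<^sub>R x))\<^sup>2 / 2)) \<partial>lborel)
            \<le> ennreal c * ennreal (exp (- (l * norm (x - x0))\<^sup>2))"
          using pos by (simp add: ennreal_mult)
      qed
      also have "\<dots> = ennreal c * (\<integral>\<^sup>+x. ennreal (exp (- (l * norm (x - x0))\<^sup>2)) \<partial>\<mu>)"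
        by (rule nn_integral_cmult) measurable
      also have "\<dots> \<le> ennreal c * ennreal (A * l powr - t)"
        by (intro mult_left_mono G l) auto
      also have "\<dots> = ennreal (c * A * (\<kappa> / sqrt 2) powr - t * norm \<xi> powr - t)"
      proof -
        have "l powr - t = (\<kappa> / sqrt 2) powr - t * norm \<xi> powr - t"
          unfolding l_def by (rule powr_mult)
        then show ?thesis
          using pos \<open>0 \<le> A\<close> by (simp add: ennreal_mult[symmetric] mult_ac)
      qed
      also have "\<dots> \<le> ennreal (K * 2 powr (- t * real k))"
      proof (rule ennreal_leI)
        have "norm \<xi> powr - t \<le> (2 ^ j) powr - t"
          using j \<open>0 \<le> t\<close> by (intro powr_mono2') auto
        also have "\<dots> = 2 powr t * 2 powr (- t * real k)"
          by (simp add: Suc powr_realpow[symmetric] powr_powr powr_add[symmetric] algebra_simps)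
        finally have "c * A * (\<kappa> / sqrt 2) powr - t * norm \<xi> powr - t
            \<le> c * A * (\<kappa> / sqrt 2) powr - t * (2 powr t * 2 powr (- t * real k))"
          using pos \<open>0 \<le> A\<close> by (intro mult_left_mono) auto
        also have "\<dots> \<le> K * 2 powr (- t * real k)"
          using pos by (simp add: K_def algebra_simps)
        finally show "c * A * (\<kappa> / sqrt 2) powr - t * norm \<xi> powr - t \<le> K * 2 powr (- t * real k)" .
      qed
      finally show ?thesis .
    qed
    \<comment> \<open>At its own scale the Gaussian is at least \<open>exp (- 1 / 2)\<close>, so
      inserting it costs a factor \<open>exp (1 / 2)\<close>.\<close>
    also have "\<dots> \<le> ennreal (K * exp (1 / 2)) * (ennreal (2 powr (- t * real k)) * ennreal (exp (- (norm \<xi> / 2 ^ k)\<^sup>2 / 2)))"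
    proof -
      have "(norm \<xi> / 2 ^ k)\<^sup>2 \<le> 1"
        using k by (intro power_le_one) auto
      then have "1 \<le> exp (1 / 2) * exp (- (norm \<xi> / 2 ^ k)\<^sup>2 / 2)"
        unfolding exp_add[symmetric] by (simp add: field_simps)
      then have "K * 2 powr (- t * real k) * 1 \<le> K * 2 powr (- t * real k) * (exp (1 / 2) * exp (- (norm \<xi> / 2 ^ k)\<^sup>2 / 2))"
        using K by (intro mult_left_mono) auto
      then show ?thesis
        using K by (simp add: ennreal_mult[symmetric] mult_ac ennreal_leI)
    qed
    also have "\<dots> \<le> ennreal (K * exp (1 / 2)) * (\<Sum>k. ennreal (2 powr (- t * real k)) * ennreal (exp (- (norm \<xi> / 2 ^ k)\<^sup>2 / 2)))"
      using sum_le_suminf[OF summableI, of "{k}" "\<lambda>k. ennreal (2 powr (- t * real k)) * ennreal (exp (- (norm \<xi> / 2 ^ k)\<^sup>2 / 2))"]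
      by (intro mult_left_mono) auto
    finally show ?thesis .
  qed
  then show ?thesis
    using K by (intro exI[of _ "K * exp (1 / 2)"]) auto
qed

section \<open>Fourier energies and slab energies\<close>

lemma nn_integral_lborel_affine:
  fixes t :: "'a::euclidean_space"
  assumes [measurable]: "f \<in> borel_measurable borel" and "0 < c"
  shows "(\<integral>\<^sup>+x. f x \<partial>lborel) = ennreal (c ^ DIM('a)) * (\<integral>\<^sup>+x. f (t + c *\<^sub>R x) \<partial>lborel)"
  using \<open>0 < c\<close>
  by (subst lborel_affine[of c t])
     (simp_all add: nn_integral_density nn_integral_distr nn_integral_cmult)

text \<open>After rescaling by \<open>s\<close>, the Gaussian identity turns the left side into a
  double integral of \<open>exp (- (s * norm (y - z))\<^sup>2 / 2)\<close>, and \<open>G\<close>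
  bounds its inner integral for each \<open>y\<close>. The energy up to frequency \<open>s\<close>
  thus grows at most like \<open>s\<close> to the power \<open>DIM('a) - t\<close>.\<close>

lemma frostman_fourier_energy:
  fixes \<mu> :: "'a::euclidean_space measure"
  assumes "finite_measure \<mu>" and [measurable_cong]: "sets \<mu> = sets borel"
    and G: "\<And>x0 l. 0 < l \<Longrightarrow>
      (\<integral>\<^sup>+x. ennreal (exp (- (l * norm (x - x0))\<^sup>2)) \<partial>\<mu>) \<le> ennreal (A * l powr - t)"
    and "0 < s" "0 \<le> A"
  shows "(\<integral>\<^sup>+\<xi>. ennreal (exp (- (norm \<xi> / s)\<^sup>2 / 2)) * ennreal (fourier_energy \<mu> \<xi>) \<partial>lborel)
     \<le> ennreal (s ^ DIM('a) * sqrt (2 * pi) ^ DIM('a) * (A * (s / sqrt 2) powr - t) * measure \<mu> (space \<mu>))"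
proof -
  interpret finite_measure \<mu> by fact
  note [measurable] = measurable_fourier_energy[OF assms(1,2)]
  have "(\<integral>\<^sup>+\<xi>. ennreal (exp (- (norm \<xi> / s)\<^sup>2 / 2)) * ennreal (fourier_energy \<mu> \<xi>) \<partial>lborel)
      = ennreal (s ^ DIM('a)) * (\<integral>\<^sup>+v. ennreal (exp (- (norm v)\<^sup>2 / 2)) * ennreal (fourier_energy \<mu> (s *\<^sub>R v)) \<partial>lborel)"
    using \<open>0 < s\<close> by (subst nn_integral_lborel_affine[of _ s 0]) auto
  also have "(\<integral>\<^sup>+v. ennreal (exp (- (norm v)\<^sup>2 / 2)) * ennreal (fourier_energy \<mu> (s *\<^sub>R v)) \<partial>lborel)
      = ennreal (sqrt (2 * pi) ^ DIM('a)) *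
           (\<integral>\<^sup>+p. ennreal (exp (- (norm (s *\<^sub>R (fst p - snd p)))\<^sup>2 / 2)) \<partial>(\<mu> \<Otimes>\<^sub>M \<mu>))"
    by (rule gaussian_energy_eq[symmetric]) (use assms in auto)
  finally have eq: "(\<integral>\<^sup>+\<xi>. ennreal (exp (- (norm \<xi> / s)\<^sup>2 / 2)) * ennreal (fourier_energy \<mu> \<xi>) \<partial>lborel)
      = ennreal (s ^ DIM('a)) * (ennreal (sqrt (2 * pi) ^ DIM('a)) * (\<integral>\<^sup>+p. ennreal (exp (- (norm (s *\<^sub>R (fst p - snd p)))\<^sup>2 / 2)) \<partial>(\<mu> \<Otimes>\<^sub>M \<mu>)))" .
  have "(\<integral>\<^sup>+p. ennreal (exp (- (norm (s *\<^sub>R (fst p - snd p)))\<^sup>2 / 2)) \<partial>(\<mu> \<Otimes>\<^sub>M \<mu>))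
      = (\<integral>\<^sup>+y. \<integral>\<^sup>+z. ennreal (exp (- (norm (s *\<^sub>R (y - z)))\<^sup>2 / 2)) \<partial>\<mu> \<partial>\<mu>)"
    by (subst nn_integral_fst[symmetric]) auto
  also have "\<dots> \<le> (\<integral>\<^sup>+y. ennreal (A * (s / sqrt 2) powr - t) \<partial>\<mu>)"
  proof (rule nn_integral_mono)
    fix y :: 'a
    have "- (norm (s *\<^sub>R (y - z)))\<^sup>2 / 2 = - (s / sqrt 2 * norm (z - y))\<^sup>2" for z
      by (simp add: power_mult_distrib power_divide norm_minus_commute)
    then show "(\<integral>\<^sup>+z. ennreal (exp (- (norm (s *\<^sub>R (y - z)))\<^sup>2 / 2)) \<partial>\<mu>) \<le> ennreal (A * (s / sqrt 2) powr - t)"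
      using G[of "s / sqrt 2" y] \<open>0 < s\<close> by simp
  qed
  also have "\<dots> = ennreal (A * (s / sqrt 2) powr - t * measure \<mu> (space \<mu>))"
    using \<open>0 \<le> A\<close> by (simp add: emeasure_eq_measure ennreal_mult)
  finally have "ennreal (s ^ DIM('a)) * (ennreal (sqrt (2 * pi) ^ DIM('a)) * (\<integral>\<^sup>+p. ennreal (exp (- (norm (s *\<^sub>R (fst p - snd p)))\<^sup>2 / 2)) \<partial>(\<mu> \<Otimes>\<^sub>M \<mu>)))
      \<le> ennreal (s ^ DIM('a)) * (ennreal (sqrt (2 * pi) ^ DIM('a)) * ennreal (A * (s / sqrt 2) powr - t * measure \<mu> (space \<mu>)))"
    by (intro mult_left_mono) auto
  also have "\<dots> = ennreal (s ^ DIM('a) * sqrt (2 * pi) ^ DIM('a) * (A * (s / sqrt 2) powr - t) * measure \<mu> (space \<mu>))"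
    using \<open>0 < s\<close> \<open>0 \<le> A\<close> by (simp add: ennreal_mult[symmetric] mult_ac)
  finally show ?thesis unfolding eq .
qed

text \<open>Up to constants, the squared \<open>L\<^sup>2\<close>-norm at scale \<open>\<delta>\<close> of the projection of \<open>\<mu>\<close> to the line spanned by \<open>x\<close>.
  The factor \<open>exp (- (norm (y - z))\<^sup>2 / 2)\<close> is harmless for compactly supported \<open>\<mu>\<close> and blurs frequencies
  at scale 1.\<close>

definition slab_energy :: "'a::euclidean_space measure \<Rightarrow> real \<Rightarrow> 'a \<Rightarrow> ennreal" where
  "slab_energy \<mu> \<delta> x = (\<integral>\<^sup>+p. ennreal (exp (- ((x \<bullet> (fst p - snd p)) / \<delta>)\<^sup>2 - (norm (fst p - snd p))\<^sup>2 / 2) / \<delta>)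
     \<partial>(\<mu> \<Otimes>\<^sub>M \<mu>))"

text \<open>Bounding the Gaussian weight in the extra variable \<open>r\<close> by 1 gives a right
  side free of \<open>\<delta>\<close>: the substitution \<open>c * r\<close> to \<open>r\<close>
  contributes \<open>1 / c\<close>, which compensates the prefactor
  \<open>1 / \<delta>\<close>.\<close>

lemma slab_energy_le:
  fixes \<mu> :: "'a::euclidean_space measure"
  assumes "finite_measure \<mu>" and [measurable_cong]: "sets \<mu> = sets borel" and "0 < \<delta>"
  shows "slab_energy \<mu> \<delta> x \<le>
    (\<integral>\<^sup>+r. \<integral>\<^sup>+\<xi>. ennreal (exp (- (norm (\<xi> - r *\<^sub>R x))\<^sup>2 / 2)) * ennreal (fourier_energy \<mu> \<xi>) \<partial>lborel \<partial>lborel)"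
proof -
  interpret finite_measure \<mu> by fact
  note [measurable] = measurable_fourier_energy[OF assms(1,2)]
  \<comment> \<open>With this value \<open>(c * u)\<^sup>2 / 2 = (u / \<delta>)\<^sup>2\<close>, so
    the slab kernel becomes a standard Gaussian in \<open>L' w\<close>.\<close>
  define c where "c = sqrt 2 / \<delta>"
  have c: "0 < c" using \<open>0 < \<delta>\<close> by (simp add: c_def)
  define L where "L = (\<lambda>q::real \<times> 'a. snd q + (c * fst q) *\<^sub>R x)"
  define L' where "L' = (\<lambda>w::'a. (c * (x \<bullet> w), w))"
  have [measurable]: "L \<in> borel_measurable borel" "L' \<in> borel_measurable borel"
    unfolding L_def L'_def by (intro borel_measurable_continuous_onI continuous_intros)+
  have adj: "L q \<bullet> w = q \<bullet> L' w" for q w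
    by (simp add: L_def L'_def inner_prod_def inner_add_left)
  let ?h = "\<lambda>r. \<integral>\<^sup>+\<xi>. ennreal (exp (- (norm (\<xi> - r *\<^sub>R x))\<^sup>2 / 2)) * ennreal (fourier_energy \<mu> \<xi>) \<partial>lborel"
  let ?c = "sqrt (2 * pi) ^ DIM(real \<times> 'a)"
  \<comment> \<open>The Gaussian normalisation is at least 1, so it may be inserted as a factor in
    an upper bound.\<close>
  have c1: "1 \<le> ?c"
    using pi_ge_two by (intro one_le_power) (simp add: real_le_rsqrt)
  have "ennreal ?c * (\<integral>\<^sup>+p. ennreal (exp (- (norm (L' (fst p - snd p)))\<^sup>2 / 2)) \<partial>(\<mu> \<Otimes>\<^sub>M \<mu>))
      = (\<integral>\<^sup>+q. ennreal (exp (- (norm q)\<^sup>2 / 2)) * ennreal (fourier_energy \<mu> (L q)) \<partial>lborel)"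
    by (rule gaussian_energy_eq) (use assms adj in auto)
  also have "\<dots> \<le> (\<integral>\<^sup>+q. ennreal (exp (- (norm (snd q))\<^sup>2 / 2)) * ennreal (fourier_energy \<mu> (L q)) \<partial>lborel)"
    by (intro nn_integral_mono mult_right_mono ennreal_leI) (auto simp: norm_Pair)
  also have "\<dots> = (\<integral>\<^sup>+r. \<integral>\<^sup>+v. ennreal (exp (- (norm v)\<^sup>2 / 2)) * ennreal (fourier_energy \<mu> (v + (c * r) *\<^sub>R x)) \<partial>lborel \<partial>lborel)"
    unfolding lborel_prod[symmetric] by (subst lborel.nn_integral_fst[symmetric]) (auto simp: L_def)
  also have "\<dots> = (\<integral>\<^sup>+r. ?h (0 + c * r) \<partial>lborel)"
  proof (rule nn_integral_cong)
    fix r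
    show "(\<integral>\<^sup>+v. ennreal (exp (- (norm v)\<^sup>2 / 2)) * ennreal (fourier_energy \<mu> (v + (c * r) *\<^sub>R x)) \<partial>lborel) = ?h (0 + c * r)"
      by (subst (2) nn_integral_lborel_affine[of _ 1 "(c * r) *\<^sub>R x"]) (auto simp: add.commute)
  qed
  finally have *: "ennreal ?c * (\<integral>\<^sup>+p. ennreal (exp (- (norm (L' (fst p - snd p)))\<^sup>2 / 2)) \<partial>(\<mu> \<Otimes>\<^sub>M \<mu>))
      \<le> (\<integral>\<^sup>+r. ?h (0 + c * r) \<partial>lborel)" .
  have "slab_energy \<mu> \<delta> x = (\<integral>\<^sup>+p. ennreal (1 / \<delta>) * ennreal (exp (- (norm (L' (fst p - snd p)))\<^sup>2 / 2)) \<partial>(\<mu> \<Otimes>\<^sub>M \<mu>))"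
  proof -
    have "- ((x \<bullet> w) / \<delta>)\<^sup>2 - (norm w)\<^sup>2 / 2 = - (norm (L' w))\<^sup>2 / 2" for w
      by (simp add: L'_def norm_Pair c_def power_mult_distrib power_divide)
    then show ?thesis
      using \<open>0 < \<delta>\<close> by (simp add: slab_energy_def ennreal_mult[symmetric])
  qed
  also have "\<dots> = ennreal (1 / \<delta>) * (\<integral>\<^sup>+p. ennreal (exp (- (norm (L' (fst p - snd p)))\<^sup>2 / 2)) \<partial>(\<mu> \<Otimes>\<^sub>M \<mu>))"
    by (rule nn_integral_cmult) measurable
  also have "\<dots> \<le> ennreal c * (ennreal ?c * (\<integral>\<^sup>+p. ennreal (exp (- (norm (L' (fst p - snd p)))\<^sup>2 / 2)) \<partial>(\<mu> \<Otimes>\<^sub>M \<mu>)))"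
  proof (rule mult_mono)
    show "ennreal (1 / \<delta>) \<le> ennreal c"
      using \<open>0 < \<delta>\<close> by (intro ennreal_leI) (simp add: c_def divide_right_mono)
    show "(\<integral>\<^sup>+p. ennreal (exp (- (norm (L' (fst p - snd p)))\<^sup>2 / 2)) \<partial>(\<mu> \<Otimes>\<^sub>M \<mu>))
      \<le> ennreal ?c * (\<integral>\<^sup>+p. ennreal (exp (- (norm (L' (fst p - snd p)))\<^sup>2 / 2)) \<partial>(\<mu> \<Otimes>\<^sub>M \<mu>))"
      using c1 mult_right_mono[of 1 "ennreal ?c"] by (simp del: DIM_prod)
  qed auto
  also have "\<dots> \<le> ennreal c * (\<integral>\<^sup>+r. ?h (0 + c * r) \<partial>lborel)"
    by (intro mult_left_mono *) auto
  also have "\<dots> = (\<integral>\<^sup>+r. ?h r \<partial>lborel)"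
    using c by (subst (2) nn_integral_real_affine[of _ c 0]) auto
  finally show ?thesis .
qed

lemma measurable_slab_energy:
  fixes \<mu> :: "'a::euclidean_space measure"
  assumes "finite_measure \<mu>" and [measurable_cong]: "sets \<mu> = sets borel"
  shows "slab_energy \<mu> \<delta> \<in> borel_measurable \<mu>"
proof -
  interpret finite_measure \<mu> by fact
  interpret P: finite_measure "\<mu> \<Otimes>\<^sub>M \<mu>"
    by (rule finite_measure_pair_measure) fact+
  show ?thesis unfolding slab_energy_def by measurable
qed

text \<open>This is where the threshold on the dimension enters. At frequency scale
  \<open>2 ^ k\<close> the cone weight contributes \<open>2 powr (- t * k)\<close> and the Fourier
  energy \<open>2 powr ((DIM('a) - t) * k)\<close>; the product is \<open>q ^ k\<close> with
  \<open>q < 1\<close>, since \<open>t\<close> exceeds half the dimension.\<close>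

lemma slab_energy_bounded:
  fixes \<mu> :: "'a::euclidean_space measure"
  assumes "finite_measure \<mu>" and [measurable_cong]: "sets \<mu> = sets borel"
    and supp: "AE x in \<mu>. x \<in> P"
    and P: "compact P" "P \<noteq> {}" "0 \<notin> P"
    and T: "\<And>x x0 s. x \<in> P \<Longrightarrow> x0 \<in> P \<Longrightarrow> norm (x - x0) \<le> C * norm (x0 - s *\<^sub>R x)" "1 \<le> C"
    and frost: "\<And>x r. 0 < r \<Longrightarrow> emeasure \<mu> (cball x r) \<le> ennreal (C' * r powr t)" "0 \<le> C'"
    and t: "DIM('a) / 2 < t"
  shows "\<exists>K. \<forall>\<delta>>0. (\<integral>\<^sup>+x. slab_energy \<mu> \<delta> x \<partial>\<mu>) \<le> ennreal K"
proof -
  interpret finite_measure \<mu> by fact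
  interpret MA: pair_sigma_finite \<mu> "lborel :: 'a measure" ..
  note [measurable] = measurable_fourier_energy[OF assms(1,2)]
  let ?\<Phi> = "\<lambda>\<xi>. ennreal (fourier_energy \<mu> \<xi>)"
  let ?E = "\<lambda>\<xi> r x. ennreal (exp (- (norm (\<xi> - r *\<^sub>R x))\<^sup>2 / 2))"
  let ?w = "\<lambda>k. ennreal (2 powr (- t * real k))"
  let ?g = "\<lambda>k \<xi>. ennreal (exp (- (norm (\<xi>::'a) / 2 ^ k)\<^sup>2 / 2))"
  have t0: "0 \<le> t" using t of_nat_0_le_iff[of "DIM('a)"] by linarith
  obtain A where A: "0 \<le> A" "\<And>x0 l. 0 < l \<Longrightarrow>
      (\<integral>\<^sup>+x. ennreal (exp (- (l * norm (x - x0))\<^sup>2)) \<partial>\<mu>) \<le> ennreal (A * l powr - t)"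
    using frostman_gaussian[OF assms(2) frost] by blast
  obtain K where K: "0 \<le> K" "\<And>\<xi>. (\<integral>\<^sup>+x. \<integral>\<^sup>+r. ?E \<xi> r x \<partial>lborel \<partial>\<mu>) \<le> ennreal K * (\<Sum>k. ?w k * ?g k \<xi>)"
    using frostman_ray_integral[OF assms(1,2) supp P T A(2,1) t0] by blast
  define b where "b = sqrt (2 * pi) ^ DIM('a) * A * sqrt 2 powr t * measure \<mu> (space \<mu>)"
  have b: "0 \<le> b" using A(1) by (simp add: b_def)
  define q where "q = 2 powr (DIM('a) - 2 * t)"
  have q: "0 \<le> q" "q < 1"
    using t by (auto simp: q_def powr_less_one)
  have "(\<integral>\<^sup>+x. slab_energy \<mu> \<delta> x \<partial>\<mu>) \<le> ennreal (K * (b * (1 / (1 - q))))" if "0 < \<delta>" for \<delta>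
  proof -
    have "(\<integral>\<^sup>+x. slab_energy \<mu> \<delta> x \<partial>\<mu>) \<le> (\<integral>\<^sup>+x. \<integral>\<^sup>+r. \<integral>\<^sup>+\<xi>. ?E \<xi> r x * ?\<Phi> \<xi> \<partial>lborel \<partial>lborel \<partial>\<mu>)"
      by (intro nn_integral_mono slab_energy_le assms that)
    also have "\<dots> = (\<integral>\<^sup>+x. \<integral>\<^sup>+\<xi>. \<integral>\<^sup>+r. ?E \<xi> r x * ?\<Phi> \<xi> \<partial>lborel \<partial>lborel \<partial>\<mu>)"
      by (intro nn_integral_cong lborel_pair.Fubini') measurable
    also have "\<dots> = (\<integral>\<^sup>+\<xi>. \<integral>\<^sup>+x. \<integral>\<^sup>+r. ?E \<xi> r x * ?\<Phi> \<xi> \<partial>lborel \<partial>\<mu> \<partial>lborel)"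
      by (rule MA.Fubini'[symmetric]) measurable
    also have "\<dots> = (\<integral>\<^sup>+\<xi>. (\<integral>\<^sup>+x. \<integral>\<^sup>+r. ?E \<xi> r x \<partial>lborel \<partial>\<mu>) * ?\<Phi> \<xi> \<partial>lborel)"
      by (simp add: nn_integral_multc)
    also have "\<dots> \<le> (\<integral>\<^sup>+\<xi>. ennreal K * (\<Sum>k. ?w k * ?g k \<xi>) * ?\<Phi> \<xi> \<partial>lborel)"
      by (intro nn_integral_mono mult_right_mono K) auto
    also have "\<dots> = (\<integral>\<^sup>+\<xi>. ennreal K * (\<Sum>k. ?w k * (?g k \<xi> * ?\<Phi> \<xi>)) \<partial>lborel)"
      by (simp add: mult.assoc flip: ennreal_suminf_multc)
    also have "\<dots> = ennreal K * (\<Sum>k. ?w k * (\<integral>\<^sup>+\<xi>. ?g k \<xi> * ?\<Phi> \<xi> \<partial>lborel))"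
      by (simp add: nn_integral_cmult nn_integral_suminf)
    also have "\<dots> \<le> ennreal K * (\<Sum>k. ennreal (b * q ^ k))"
    proof (intro mult_left_mono suminf_le summableI)
      fix k :: nat
      have "?w k * (\<integral>\<^sup>+\<xi>. ?g k \<xi> * ?\<Phi> \<xi> \<partial>lborel) \<le> ?w k * ennreal ((2 ^ k) ^ DIM('a) * sqrt (2 * pi) ^ DIM('a)
          * (A * (2 ^ k / sqrt 2) powr - t) * measure \<mu> (space \<mu>))"
        by (intro mult_left_mono frostman_fourier_energy assms A) auto
      also have "\<dots> = ennreal (b * (2 powr (- t * real k) * (2 ^ k) ^ DIM('a) * (2 ^ k) powr - t))"
        using A(1) by (simp add: ennreal_mult[symmetric] b_def powr_divide powr_minus field_simps)
      also have "2 powr (- t * real k) * (2 ^ k) ^ DIM('a) * (2 ^ k) powr - t = q ^ k"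
        by (simp add: q_def powr_realpow[symmetric] powr_powr powr_add[symmetric] algebra_simps
            flip: power_mult of_nat_mult)
      finally show "?w k * (\<integral>\<^sup>+\<xi>. ?g k \<xi> * ?\<Phi> \<xi> \<partial>lborel) \<le> ennreal (b * q ^ k)" .
    qed auto
    also have "(\<Sum>k. ennreal (b * q ^ k)) = ennreal (b * (1 / (1 - q)))"
      using b q by (intro suminf_ennreal_eq sums_mult geometric_sums) auto
    finally show ?thesis
      using K(1) b q by (simp add: ennreal_mult[symmetric])
  qed
  then show ?thesis by blast
qed

subsection \<open>Measure of the projections\<close>

text \<open>A compact null projection meets so few grid intervals of length \<open>\<delta>\<close>
  that their total length is at most \<open>\<epsilon>\<close>. By Cauchy-Schwarz the mass must then
  concentrate on pairs of points in a common slab, and on such pairs the kernel is at least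
  \<open>exp (- 1 - D\<^sup>2 / 2) / \<delta>\<close>.\<close>

lemma slab_energy_lower_bound:
  fixes \<mu> :: "'a::euclidean_space measure"
  assumes "finite_measure \<mu>" and sets_eq [measurable_cong]: "sets \<mu> = sets borel"
    and P: "compact P" "AE y in \<mu>. y \<in> P"
    and D: "\<And>y z. y \<in> P \<Longrightarrow> z \<in> P \<Longrightarrow> norm (y - z) \<le> D"
    and null: "emeasure lborel ((\<lambda>y. x \<bullet> y) ` P) = 0" and "0 < \<epsilon>"
  shows "\<exists>d>0. \<forall>\<delta>. 0 < \<delta> \<longrightarrow> \<delta> < d \<longrightarrow>
    ennreal (exp (- 1 - D\<^sup>2 / 2) * ((measure \<mu> (space \<mu>))\<^sup>2 / \<epsilon>)) \<le> slab_energy \<mu> \<delta> x"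
proof -
  interpret finite_measure \<mu> by fact
  define K where "K = (\<lambda>y. x \<bullet> y) ` P"
  have K: "compact K"
    unfolding K_def by (intro compact_continuous_image continuous_intros P)
  then have Kb: "K \<in> sets borel" by (intro borel_compact)
  obtain U where U: "open U" "K \<subseteq> U" "emeasure lborel (U - K) < ennreal \<epsilon>"
    using outer_regular_lborel[OF Kb \<open>0 < \<epsilon>\<close>] by blast
  have "emeasure lborel U \<le> emeasure lborel (U - K) + emeasure lborel K"
    using emeasure_subadditive[of "U - K" lborel K] U(1,2) Kb by (simp add: Un_absorb2)
  then have U\<epsilon>: "emeasure lborel U \<le> ennreal \<epsilon>"
    using U(3) null by (simp add: K_def)
  \<comment> \<open>An interval of length \<open>\<delta> < d\<close> that meets \<open>K\<close>
    stays inside \<open>U\<close>; this yields the count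
    \<open>card J * \<delta> \<le> \<epsilon>\<close> below.\<close>
  obtain d where d: "0 < d" "(\<Union>k\<in>K. ball k d) \<subseteq> U"
    using compact_subset_open_imp_ball_epsilon_subset[OF K U(1,2)] by blast
  have "ennreal (exp (- 1 - D\<^sup>2 / 2) * ((measure \<mu> (space \<mu>))\<^sup>2 / \<epsilon>)) \<le> slab_energy \<mu> \<delta> x"
    if \<delta>: "0 < \<delta>" "\<delta> < d" for \<delta>
  proof -
    define J where "J = (\<lambda>k. \<lfloor>k / \<delta>\<rfloor>) ` K"
    obtain b where b: "\<And>k. k \<in> K \<Longrightarrow> \<bar>k\<bar> \<le> b"
      using compact_imp_bounded[OF K] by (auto simp: bounded_real)
    have "\<lfloor>k / \<delta>\<rfloor> \<in> {\<lfloor>- b / \<delta>\<rfloor> .. \<lfloor>b / \<delta>\<rfloor>}" if "k \<in> K" for k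
      unfolding atLeastAtMost_iff using b[OF that] \<delta>(1)
      by (intro conjI floor_mono divide_right_mono) auto
    then have "J \<subseteq> {\<lfloor>- b / \<delta>\<rfloor> .. \<lfloor>b / \<delta>\<rfloor>}"
      unfolding J_def by blast
    then have finJ: "finite J" using finite_subset by blast
    define I where "I j = {\<delta> * of_int j ..< \<delta> * (of_int j + 1)}" for j :: int
    have I_iff: "u \<in> I j \<longleftrightarrow> \<lfloor>u / \<delta>\<rfloor> = j" for u j
      using \<delta>(1) by (auto simp: I_def floor_eq_iff field_simps)
    have I_sub: "I j \<subseteq> U" if j: "j \<in> J" for j
    proof
      fix u assume u: "u \<in> I j"
      obtain k where k: "k \<in> K" "k \<in> I j"
        using j by (auto simp: J_def I_iff)
      then have "dist k u < d"
        using u \<delta> by (auto simp: I_def dist_real_def algebra_simps)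
      then have "u \<in> (\<Union>k\<in>K. ball k d)" using k(1) by auto
      then show "u \<in> U" using d(2) by blast
    qed
    have "ennreal (real (card J) * \<delta>) = (\<Sum>j\<in>J. emeasure lborel (I j))"
      using \<delta>(1) by (simp add: I_def algebra_simps ennreal_of_nat_eq_real_of_nat ennreal_mult)
    also have "\<dots> = emeasure lborel (\<Union>j\<in>J. I j)"
      by (rule sum_emeasure) (auto simp: disjoint_family_on_def I_iff finJ, simp add: I_def)
    also have "\<dots> \<le> emeasure lborel U"
      using I_sub U(1) by (intro emeasure_mono) auto
    finally have cardJ: "real (card J) * \<delta> \<le> \<epsilon>"
      using U\<epsilon> \<open>0 < \<epsilon>\<close> by (metis ennreal_le_iff less_imp_le order_trans)
    define S where "S j = {y \<in> P. \<lfloor>(x \<bullet> y) / \<delta>\<rfloor> = j}" for j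
    have [measurable]: "P \<in> sets borel" using P(1) by (rule borel_compact)
    have S [measurable]: "S j \<in> sets borel" for j
      unfolding S_def by measurable
    have disj: "disjoint_family_on S J"
      by (auto simp: disjoint_family_on_def S_def)
    have "measure \<mu> (space \<mu>) = measure \<mu> P"
      using P(2) by (intro finite_measure_eq_AE) (auto simp: sets_eq sets_eq_imp_space_eq[OF sets_eq])
    also have "P = (\<Union>j\<in>J. S j)"
      by (auto simp: S_def J_def K_def)
    also have "measure \<mu> \<dots> = (\<Sum>j\<in>J. measure \<mu> (S j))"
      using finJ disj S by (intro finite_measure_finite_Union) (auto simp: sets_eq)
    finally have m: "measure \<mu> (space \<mu>) = (\<Sum>j\<in>J. measure \<mu> (S j))" .
    define q where "q = (\<Sum>j\<in>J. (measure \<mu> (S j))\<^sup>2)"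
    have q0: "0 \<le> q" by (simp add: q_def sum_nonneg)
    \<comment> \<open>Cauchy-Schwarz over the \<open>card J\<close> slabs.\<close>
    have "(measure \<mu> (space \<mu>))\<^sup>2 * \<delta> \<le> (q * real (card J)) * \<delta>"
      unfolding m q_def using \<delta>(1) sum_squared_le_sum_of_squares by (intro mult_right_mono) auto
    also have "\<dots> \<le> q * \<epsilon>"
      using mult_left_mono[OF cardJ q0] by (simp add: mult.assoc)
    finally have CS: "(measure \<mu> (space \<mu>))\<^sup>2 / \<epsilon> \<le> q / \<delta>"
      using \<delta>(1) \<open>0 < \<epsilon>\<close> by (simp add: field_simps)
    define W where "W = (\<Union>j\<in>J. S j \<times> S j)"
    have SS: "S j \<times> S j \<in> sets (\<mu> \<Otimes>\<^sub>M \<mu>)" for j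
      using S by (intro pair_measureI) (auto simp: sets_eq)
    have "emeasure (\<mu> \<Otimes>\<^sub>M \<mu>) W = (\<Sum>j\<in>J. emeasure (\<mu> \<Otimes>\<^sub>M \<mu>) (S j \<times> S j))"
      unfolding W_def using finJ SS by (intro sum_emeasure[symmetric]) (auto simp: disjoint_family_on_def S_def)
    also have "\<dots> = (\<Sum>j\<in>J. ennreal ((measure \<mu> (S j))\<^sup>2))"
      using S by (intro sum.cong)
        (auto simp: emeasure_pair_measure_Times sets_eq emeasure_eq_measure ennreal_mult power2_eq_square)
    also have "\<dots> = ennreal q"
      by (simp add: q_def sum_ennreal)
    finally have W: "emeasure (\<mu> \<Otimes>\<^sub>M \<mu>) W = ennreal q" .
    have Wm: "W \<in> sets (\<mu> \<Otimes>\<^sub>M \<mu>)"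
      unfolding W_def using finJ SS by (intro sets.finite_UN) auto
    define e where "e = exp (- 1 - D\<^sup>2 / 2) / \<delta>"
    have "ennreal (exp (- 1 - D\<^sup>2 / 2) * ((measure \<mu> (space \<mu>))\<^sup>2 / \<epsilon>)) \<le> ennreal (exp (- 1 - D\<^sup>2 / 2) * (q / \<delta>))"
      by (intro ennreal_leI mult_left_mono CS) auto
    also have "\<dots> = ennreal e * emeasure (\<mu> \<Otimes>\<^sub>M \<mu>) W"
      using W q0 \<delta>(1) by (simp add: e_def ennreal_mult[symmetric])
    also have "\<dots> = (\<integral>\<^sup>+p. ennreal e * indicator W p \<partial>(\<mu> \<Otimes>\<^sub>M \<mu>))"
      using Wm by (simp add: nn_integral_cmult_indicator)
    also have "\<dots> \<le> slab_energy \<mu> \<delta> x"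
      unfolding slab_energy_def
    proof (rule nn_integral_mono)
      fix p
      have "e \<le> exp (- ((x \<bullet> (fst p - snd p)) / \<delta>)\<^sup>2 - (norm (fst p - snd p))\<^sup>2 / 2) / \<delta>" if p: "p \<in> W"
      proof -
        obtain y z j where yz: "p = (y, z)" "y \<in> S j" "z \<in> S j"
          using p by (auto simp: W_def)
        have "\<bar>(x \<bullet> (y - z)) / \<delta>\<bar> \<le> 1"
          using yz(2,3) unfolding S_def inner_diff_right diff_divide_distrib by (auto; linarith)
        then have "((x \<bullet> (y - z)) / \<delta>)\<^sup>2 \<le> 1"
          by (simp only: abs_square_le_1)
        moreover have "(norm (y - z))\<^sup>2 \<le> D\<^sup>2"
          using yz(2,3) by (intro power_mono D) (auto simp: S_def)
        ultimately show ?thesis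
          using \<delta>(1) by (simp add: e_def yz(1) divide_right_mono)
      qed
      then show "ennreal e * indicator W p
          \<le> ennreal (exp (- ((x \<bullet> (fst p - snd p)) / \<delta>)\<^sup>2 - (norm (fst p - snd p))\<^sup>2 / 2) / \<delta>)"
        by (auto simp: indicator_def intro!: ennreal_leI)
    qed
    finally show ?thesis .
  qed
  then show ?thesis using d(1) by blast
qed

lemma exists_projection_pos_measure:
  fixes \<mu> :: "'a::euclidean_space measure"
  assumes "finite_measure \<mu>" "sets \<mu> = sets borel" "0 < measure \<mu> (space \<mu>)"
    and P: "compact P" "AE y in \<mu>. y \<in> P"
    and K: "\<And>\<delta>. 0 < \<delta> \<Longrightarrow> (\<integral>\<^sup>+x. slab_energy \<mu> \<delta> x \<partial>\<mu>) \<le> ennreal K"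
  shows "\<exists>x\<in>P. 0 < emeasure lborel ((\<lambda>y. x \<bullet> y) ` P)"
proof (rule ccontr)
  interpret finite_measure \<mu> by fact
  assume "\<not> ?thesis"
  then have null: "emeasure lborel ((\<lambda>y. x \<bullet> y) ` P) = 0" if "x \<in> P" for x
    using that by (auto simp: zero_less_iff_neq_zero)
  obtain b where b: "\<And>y. y \<in> P \<Longrightarrow> norm y \<le> b"
    using compact_imp_bounded[OF P(1)] by (auto simp: bounded_iff)
  have D: "norm (y - z) \<le> 2 * b" if "y \<in> P" "z \<in> P" for y z
    using norm_triangle_ineq4[of y z] b[OF that(1)] b[OF that(2)] by linarith
  define c where "c = exp (- 1 - (2 * b)\<^sup>2 / 2) * (measure \<mu> (space \<mu>))\<^sup>2"
  have c: "0 < c" using assms(3) by (simp add: c_def)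
  \<comment> \<open>Fatou's lemma is about sequences, hence the discrete scales
    \<open>1 / real (Suc n)\<close>.\<close>
  have lim: "liminf (\<lambda>n. slab_energy \<mu> (1 / real (Suc n)) x) = top" if x: "x \<in> P" for x
  proof (rule ccontr)
    assume "liminf (\<lambda>n. slab_energy \<mu> (1 / real (Suc n)) x) \<noteq> top"
    then obtain r where r: "0 \<le> r" "liminf (\<lambda>n. slab_energy \<mu> (1 / real (Suc n)) x) = ennreal r"
      by (cases "liminf (\<lambda>n. slab_energy \<mu> (1 / real (Suc n)) x)") auto
    \<comment> \<open>The value \<open>\<epsilon> = c / (r + 1)\<close> makes the lower bound equal
      to \<open>r + 1\<close>, which exceeds the supposed limit inferior \<open>r\<close>.\<close>
    obtain d where d: "0 < d" "\<And>\<delta>. 0 < \<delta> \<Longrightarrow> \<delta> < d \<Longrightarrow>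
        ennreal (exp (- 1 - (2 * b)\<^sup>2 / 2) * ((measure \<mu> (space \<mu>))\<^sup>2 / (c / (r + 1)))) \<le> slab_energy \<mu> \<delta> x"
      using slab_energy_lower_bound[OF assms(1,2) P D null[OF x], of "c / (r + 1)"] c r(1) by auto
    have "exp (- 1 - (2 * b)\<^sup>2 / 2) * ((measure \<mu> (space \<mu>))\<^sup>2 / (c / (r + 1))) = c / (c / (r + 1))"
      by (simp add: c_def)
    also have "\<dots> = r + 1"
      using c by simp
    finally have eq: "exp (- 1 - (2 * b)\<^sup>2 / 2) * ((measure \<mu> (space \<mu>))\<^sup>2 / (c / (r + 1))) = r + 1" .
    have "eventually (\<lambda>n. inverse (real (Suc n)) < d) sequentially"
      using LIMSEQ_inverse_real_of_nat d(1) by (rule order_tendstoD)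
    then have "eventually (\<lambda>n. ennreal (r + 1) \<le> slab_energy \<mu> (1 / real (Suc n)) x) sequentially"
      by eventually_elim (use d(2)[unfolded eq] in \<open>simp add: inverse_eq_divide\<close>)
    then have "ennreal (r + 1) \<le> liminf (\<lambda>n. slab_energy \<mu> (1 / real (Suc n)) x)"
      by (rule Liminf_bounded)
    then show False using r by simp
  qed
  have "top * emeasure \<mu> (space \<mu>) = (\<integral>\<^sup>+x. top \<partial>\<mu>)"
    by simp
  also have "\<dots> = (\<integral>\<^sup>+x. liminf (\<lambda>n. slab_energy \<mu> (1 / real (Suc n)) x) \<partial>\<mu>)"
    by (intro nn_integral_cong_AE eventually_mono[OF P(2)]) (simp only: lim)
  also have "\<dots> \<le> liminf (\<lambda>n. \<integral>\<^sup>+x. slab_energy \<mu> (1 / real (Suc n)) x \<partial>\<mu>)"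
    by (intro nn_integral_liminf measurable_slab_energy assms)
  also have "\<dots> \<le> liminf (\<lambda>n. ennreal K)"
    by (intro Liminf_mono always_eventually allI K) simp
  also have "\<dots> = ennreal K"
    by (simp add: Liminf_const)
  finally show False
    using assms(3) by (simp add: emeasure_eq_measure ennreal_top_mult top_unique split: if_splits)
qed

lemma transversal_projection:
  fixes P :: "'a::euclidean_space set"
  assumes P: "compact P" "P \<noteq> {}" "0 \<notin> P"
    and T: "\<And>x x0 s. x \<in> P \<Longrightarrow> x0 \<in> P \<Longrightarrow> norm (x - x0) \<le> C * norm (x0 - s *\<^sub>R x)" "1 \<le> C"
    and \<delta>: "0 < \<delta>" "0 < hausdorff_content \<delta> t P" and t: "DIM('a) / 2 < t"
  shows "\<exists>x\<in>P. 0 < emeasure lborel ((\<lambda>y. x \<bullet> y) ` P)"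
proof -
  have "0 < t" using t of_nat_0_le_iff[of "DIM('a)"] by linarith
  then obtain \<mu> C' where \<mu>: "finite_measure \<mu>" "sets \<mu> = sets borel" "0 < measure \<mu> (space \<mu>)"
      "AE x in \<mu>. x \<in> P"
    and C': "0 \<le> C'" "\<And>x r. 0 < r \<Longrightarrow> emeasure \<mu> (cball x r) \<le> ennreal (C' * r powr t)"
    using frostman[OF P(1) \<delta>] by blast
  obtain K where "\<And>\<delta>. 0 < \<delta> \<Longrightarrow> (\<integral>\<^sup>+x. slab_energy \<mu> \<delta> x \<partial>\<mu>) \<le> ennreal K"
    using slab_energy_bounded[OF \<mu>(1,2,4) P T C'(2,1) t] by blast
  then show ?thesis
    by (intro exists_projection_pos_measure[OF \<mu>(1-3) P(1) \<mu>(4)])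
qed

section \<open>Decomposition of spheres into transversal pieces\<close>

text \<open>Write \<open>y - x = \<tau> *\<^sub>R x + w\<close> and pair it with the normal
  \<open>x - p\<close>. Because both points are on the sphere, the left side gives only the
  second-order term \<open>- h\<^sup>2 / 2\<close>, and \<open>\<eta> \<le> \<bar>u\<bar>\<close>
  says that the ray is not tangent; hence \<open>\<tau>\<close> is controlled by
  \<open>h\<^sup>2\<close> and \<open>norm w\<close>.\<close>

lemma sphere_transversal:
  fixes p x y :: "'a::real_inner"
  assumes "norm (x - p) = R" "norm (y - p) = R" and \<eta>: "0 < \<eta>" "\<eta> \<le> \<bar>x \<bullet> (x - p)\<bar>"
    and B: "0 < B" "norm x \<le> B" and near: "norm (x - y) \<le> \<eta> / B"
  shows "norm (x - y) \<le> 2 * (B * R / \<eta> + 1) * norm (y - s *\<^sub>R x)"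
proof -
  define h w \<tau> where "h = norm (x - y)" and "w = y - s *\<^sub>R x" and "\<tau> = s - 1"
  define u v where "u = x \<bullet> (x - p)" and "v = w \<bullet> (x - p)"
  have eq: "y - x = \<tau> *\<^sub>R x + w"
    by (simp add: w_def \<tau>_def algebra_simps)
  have "(norm (y - p))\<^sup>2 = (norm ((y - x) + (x - p)))\<^sup>2" by simp
  also have "\<dots> = (norm (y - x))\<^sup>2 + 2 * ((y - x) \<bullet> (x - p)) + (norm (x - p))\<^sup>2"
    by (simp only: power2_norm_eq_inner inner_add inner_commute[of "x - p" "y - x"])
  finally have "2 * ((y - x) \<bullet> (x - p)) = - h\<^sup>2"
    using assms(1,2) by (simp add: h_def norm_minus_commute)
  then have "2 * (\<tau> * u + v) = - h\<^sup>2"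
    unfolding eq inner_add_left inner_scaleR_left u_def v_def .
  then have "\<tau> * u = - h\<^sup>2 / 2 - v" by simp
  then have "\<bar>\<tau>\<bar> * \<bar>u\<bar> \<le> h\<^sup>2 / 2 + \<bar>v\<bar>"
    unfolding abs_mult[symmetric] using zero_le_power2[of h] by linarith
  moreover have "\<bar>v\<bar> \<le> norm w * R"
    using Cauchy_Schwarz_ineq2[of w "x - p"] assms(1) by (simp add: v_def)
  moreover have "\<bar>\<tau>\<bar> * \<eta> \<le> \<bar>\<tau>\<bar> * \<bar>u\<bar>"
    using \<eta> by (intro mult_left_mono) (auto simp: u_def)
  ultimately have 1: "\<bar>\<tau>\<bar> * \<eta> \<le> h\<^sup>2 / 2 + norm w * R" by linarith
  have "h \<le> \<bar>\<tau>\<bar> * norm x + norm w"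
    using norm_triangle_ineq[of "\<tau> *\<^sub>R x" w] unfolding eq[symmetric]
    by (simp add: h_def norm_minus_commute)
  also have "\<dots> \<le> \<bar>\<tau>\<bar> * B + norm w"
    using B by (intro add_right_mono mult_left_mono) auto
  finally have "\<eta> * h \<le> \<eta> * (\<bar>\<tau>\<bar> * B + norm w)"
    using \<eta> by (intro mult_left_mono) auto
  also have "\<dots> = B * (\<bar>\<tau>\<bar> * \<eta>) + \<eta> * norm w" by (simp add: algebra_simps)
  also have "\<dots> \<le> B * (h\<^sup>2 / 2 + norm w * R) + \<eta> * norm w"
    using 1 B by (intro add_right_mono mult_left_mono) auto
  also have "\<dots> = (B * h) * h / 2 + (B * R + \<eta>) * norm w"
    by (simp add: power2_eq_square algebra_simps)
  \<comment> \<open>Nearness gives \<open>B * h \<le> \<eta>\<close>, so the quadratic term is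
    absorbed by half of the left side.\<close>
  also have "\<dots> \<le> \<eta> * h / 2 + (B * R + \<eta>) * norm w"
    using near B by (intro add_right_mono divide_right_mono mult_right_mono) (auto simp: h_def field_simps)
  finally have "\<eta> * h \<le> 2 * ((B * R + \<eta>) * norm w)" by linarith
  then show ?thesis
    using \<eta>(1) by (simp add: h_def[symmetric] w_def[symmetric] field_simps)
qed

text \<open>Transversality is only local, so \<open>E\<close> is cut by finitely many balls and one
  piece of positive content is kept. Its projection is contained in that of
  \<open>E\<close>.\<close>

lemma sphere_piece_projection:
  fixes E :: "'a::euclidean_space set"
  assumes E: "compact E" and sph: "\<And>x. x \<in> E \<Longrightarrow> norm (x - p) = R"
    and \<eta>: "0 < \<eta>" "\<And>x. x \<in> E \<Longrightarrow> \<eta> \<le> \<bar>x \<bullet> (x - p)\<bar>"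
    and "0 < \<delta>" "0 < hausdorff_content \<delta> t E" "DIM('a) / 2 < t"
  shows "\<exists>x\<in>E. 0 < emeasure lborel ((\<lambda>y. x \<bullet> y) ` E)"
proof -
  obtain B where B: "0 < B" "\<And>x. x \<in> E \<Longrightarrow> norm x \<le> B"
    using compact_imp_bounded[OF E] by (auto simp: bounded_pos)
  \<comment> \<open>Two points in a common ball of radius \<open>r\<close> are then within the
    distance \<open>\<eta> / B\<close> demanded by \<open>sphere_transversal\<close>.\<close>
  define r where "r = \<eta> / B / 2"
  have r: "0 < r" using \<eta>(1) B(1) by (simp add: r_def)
  obtain F where F: "finite F" "E \<subseteq> (\<Union>x\<in>F. ball x r)"
    using seq_compact_imp_totally_bounded[OF compact_imp_seq_compact[OF E]] r by blast
  have "E \<subseteq> (\<Union>i. E \<inter> cball (from_nat_into F i) r)"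
  proof
    fix x assume x: "x \<in> E"
    then obtain z where z: "z \<in> F" "x \<in> ball z r" using F(2) by blast
    then obtain i where "from_nat_into F i = z"
      using from_nat_into_surj[OF countable_finite[OF F(1)]] by blast
    then show "x \<in> (\<Union>i. E \<inter> cball (from_nat_into F i) r)"
      using x z(2) by (auto intro!: exI[of _ i])
  qed
  then obtain i where i: "0 < hausdorff_content \<delta> t (E \<inter> cball (from_nat_into F i) r)"
    using hausdorff_content_pos_UN[OF assms(6)] by blast
  define P where "P = E \<inter> cball (from_nat_into F i) r"
  have PE: "P \<subseteq> E" by (simp add: P_def)
  have P: "compact P" using E by (auto simp: P_def intro: compact_Int_closed)
  have P_ne: "P \<noteq> {}"
    using i assms(5) hausdorff_content_empty[of \<delta> t, where 'a='a] by (auto simp: P_def)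
  then obtain x1 where "x1 \<in> E" using PE by blast
  then have R: "0 \<le> R" using sph norm_ge_zero by metis
  \<comment> \<open>At the origin \<open>x \<bullet> (x - p)\<close> would vanish, contrary to the
    lower bound \<open>\<eta>\<close>.\<close>
  have P0: "0 \<notin> P" using \<eta> PE by force
  have T: "norm (x - y) \<le> 2 * (B * R / \<eta> + 1) * norm (y - s *\<^sub>R x)" if "x \<in> P" "y \<in> P" for x y s
  proof -
    have xy: "x \<in> E" "y \<in> E" using that PE by auto
    have "dist x y \<le> 2 * r"
      using that dist_triangle3[of x y "from_nat_into F i"] by (auto simp: P_def)
    then have "norm (x - y) \<le> \<eta> / B" by (simp add: r_def dist_norm)
    then show ?thesis
      by (intro sphere_transversal[OF sph[OF xy(1)] sph[OF xy(2)] \<eta>(1) \<eta>(2)[OF xy(1)] B(1) B(2)[OF xy(1)]])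
  qed
  have "0 \<le> B * R / \<eta>" using R B(1) \<eta>(1) by simp
  then obtain x where x: "x \<in> P" "0 < emeasure lborel ((\<lambda>y. x \<bullet> y) ` P)"
    using transversal_projection[OF P P_ne P0 T _ assms(5) _ assms(7)] i by (auto simp: P_def)
  have "compact ((\<lambda>y. x \<bullet> y) ` E)"
    by (intro compact_continuous_image continuous_intros E)
  then have "emeasure lborel ((\<lambda>y. x \<bullet> y) ` P) \<le> emeasure lborel ((\<lambda>y. x \<bullet> y) ` E)"
    using PE by (intro emeasure_mono) (auto simp: borel_compact)
  then show ?thesis using x PE by (auto intro: less_le_trans)
qed

lemma unit_sphere_projection:
  fixes E :: "'a::euclidean_space set"
  assumes E: "compact E" and sph: "\<And>x. x \<in> E \<Longrightarrow> norm (x - a) = 1"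
    and dim: "hausdorff_dim E > ennreal (DIM('a) / 2)"
  shows "\<exists>x\<in>E. 0 < emeasure lborel ((\<lambda>y. x \<bullet> y) ` E)"
proof -
  obtain t \<delta> where t: "DIM('a) / 2 < t" and \<delta>: "0 < \<delta>" and pos: "0 < hausdorff_content \<delta> t E"
    using hausdorff_dim_gt_imp_content_pos[OF dim] by auto
  have t0: "0 < t" using t of_nat_0_le_iff[of "DIM('a)"] by linarith
  \<comment> \<open>Index 0 collects the points where the ray is tangent to the sphere; the other
    indices bound the deviation from tangency below by \<open>1 / Suc n\<close>.\<close>
  define A where "A i = (case i of 0 \<Rightarrow> {x \<in> E. x \<bullet> (x - a) = 0}
      | Suc n \<Rightarrow> {x \<in> E. inverse (real (Suc n)) \<le> \<bar>x \<bullet> (x - a)\<bar>})" for i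
  have "E \<subseteq> (\<Union>i. A i)"
  proof
    fix x assume x: "x \<in> E"
    show "x \<in> (\<Union>i. A i)"
    proof (cases "x \<bullet> (x - a) = 0")
      case True
      then have "x \<in> A 0" using x by (simp add: A_def)
      then show ?thesis by blast
    next
      case False
      then obtain n where "inverse (real (Suc n)) < \<bar>x \<bullet> (x - a)\<bar>"
        using reals_Archimedean[of "\<bar>x \<bullet> (x - a)\<bar>"] by auto
      then have "x \<in> A (Suc n)" using x by (simp add: A_def)
      then show ?thesis by blast
    qed
  qed
  then obtain i where i: "0 < hausdorff_content \<delta> t (A i)"
    using hausdorff_content_pos_UN[OF pos] by blast
  have AE: "A i \<subseteq> E" by (auto simp: A_def split: nat.split)
  have "\<exists>x\<in>A i. 0 < emeasure lborel ((\<lambda>y. x \<bullet> y) ` A i)"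
  proof (cases i)
    case (Suc n)
    have cl: "closed {x. inverse (real (Suc n)) \<le> \<bar>x \<bullet> (x - a)\<bar>}"
      by (intro closed_Collect_le continuous_intros)
    have "A i = E \<inter> {x. inverse (real (Suc n)) \<le> \<bar>x \<bullet> (x - a)\<bar>}"
      by (auto simp: A_def Suc)
    then have "compact (A i)" using E cl by (simp add: compact_Int_closed)
    then show ?thesis
      by (rule sphere_piece_projection[where p=a and R=1 and \<eta>="inverse (real (Suc n))"])
        (use sph AE i t \<delta> in \<open>auto simp: A_def Suc\<close>)
  next
    case 0
    have cl: "closed {x. x \<bullet> (x - a) = 0}"
      by (intro closed_Collect_eq continuous_intros)
    have "A i = E \<inter> {x. x \<bullet> (x - a) = 0}"
      by (auto simp: A_def 0)
    then have cA: "compact (A i)" using E cl by (simp add: compact_Int_closed)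
    \<comment> \<open>The common length of the tangents from the origin to the sphere, by Pythagoras
      with hypotenuse \<open>a\<close> and leg 1.\<close>
    define \<rho> where "\<rho> = sqrt (a \<bullet> a - 1)"
    have \<rho>: "norm x = \<rho>" if "x \<in> A i" for x
    proof -
      have "x \<bullet> x = x \<bullet> a" using that by (simp add: A_def 0 inner_diff_right)
      moreover have "(x - a) \<bullet> (x - a) = 1"
        using sph[of x] that AE by (auto simp flip: power2_norm_eq_inner)
      ultimately have "x \<bullet> x = a \<bullet> a - 1"
        by (simp add: inner_diff_left inner_diff_right inner_commute)
      then show ?thesis by (simp add: norm_eq_sqrt_inner \<rho>_def)
    qed
    \<comment> \<open>Otherwise the piece is contained in a single point, whose content vanishes for
      positive exponents.\<close>
    have "\<rho> \<noteq> 0"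
    proof
      assume "\<rho> = 0"
      then have "A i \<subseteq> {0}" using \<rho> by auto
      then have "hausdorff_content \<delta> t (A i) \<le> hausdorff_content \<delta> t {0::'a}"
        by (rule hausdorff_content_mono)
      also have "\<dots> \<le> diam_power t {0::'a}"
        using \<delta> by (intro hausdorff_content_le_diam_power) auto
      also have "\<dots> = 0" using t0 by (simp add: diam_power_def)
      finally show False using i by simp
    qed
    \<comment> \<open>On the sphere of radius \<open>\<rho>\<close> about the origin
      \<open>x \<bullet> (x - 0)\<close> is constantly \<open>\<rho>\<^sup>2\<close>, so this value
      serves as \<open>\<eta>\<close>.\<close>
    then show ?thesis
      by (intro sphere_piece_projection[where p=0 and R=\<rho> and \<eta>="\<rho>\<^sup>2"])
        (use cA \<rho> i t \<delta> in \<open>auto simp flip: power2_norm_eq_inner\<close>)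
  qed
  then obtain x where x: "x \<in> A i" "0 < emeasure lborel ((\<lambda>y. x \<bullet> y) ` A i)" by blast
  have "compact ((\<lambda>y. x \<bullet> y) ` E)"
    by (intro compact_continuous_image continuous_intros E)
  then have "emeasure lborel ((\<lambda>y. x \<bullet> y) ` A i) \<le> emeasure lborel ((\<lambda>y. x \<bullet> y) ` E)"
    using AE by (intro emeasure_mono) (auto simp: borel_compact)
  then show ?thesis using x AE by (auto intro: less_le_trans)
qed

theorem theorem3p1:
  fixes a :: "real ^ 'n" and E :: "(real ^ 'n) set"
  assumes "CARD('n) \<ge> 2"
    and "compact E"
    and "E \<subseteq> {a + x | x. norm x = 1}"
    and "hausdorff_dim E > ennreal (real CARD('n) / 2)"
  shows "(\<exists>x\<in>E. emeasure lebesgue (pinned_dot_set x E) > 0) \<and>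
         emeasure lebesgue (dot_set E) > 0"
proof -
  have "norm (x - a) = 1" if "x \<in> E" for x
    using assms(3) that by auto
  then obtain x where x: "x \<in> E" "0 < emeasure lborel ((\<lambda>y. x \<bullet> y) ` E)"
    using unit_sphere_projection[OF assms(2), of a] assms(4) by auto
  have pin: "pinned_dot_set x E = (\<lambda>y. x \<bullet> y) ` E"
    by (auto simp: pinned_dot_set_def)
  \<comment> \<open>Compactness makes the image a Borel set, on which \<open>lborel\<close> and
    \<open>lebesgue\<close> agree.\<close>
  have "compact ((\<lambda>y. x \<bullet> y) ` E)"
    by (intro compact_continuous_image continuous_intros assms(2))
  then have 1: "0 < emeasure lebesgue (pinned_dot_set x E)"
    using x(2) by (simp add: pin borel_compact)
  have "dot_set E = (\<lambda>(x, y). x \<bullet> y) ` (E \<times> E)"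
    by (auto simp: dot_set_def)
  \<comment> \<open>Measurability of the larger set is required for monotonicity of
    \<open>emeasure\<close>, whose value on nonmeasurable sets is 0 by convention.\<close>
  moreover have "compact ((\<lambda>(x, y). x \<bullet> y) ` (E \<times> E))"
    unfolding split_beta by (intro compact_continuous_image continuous_intros compact_Times assms(2))
  ultimately have "dot_set E \<in> sets lebesgue"
    by (simp add: borel_compact)
  moreover have "pinned_dot_set x E \<subseteq> dot_set E"
    using x(1) by (auto simp: pinned_dot_set_def dot_set_def)
  ultimately have "emeasure lebesgue (pinned_dot_set x E) \<le> emeasure lebesgue (dot_set E)"
    by (intro emeasure_mono)
  then show ?thesis using 1 x(1) by (auto intro: less_le_trans)
qed

end
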